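(* Let $n\ge2$, $\mu$ a partition with $\mu_n=0$, and let $(w,T)\in\overline{\mathcal F}(\mu)$. Put $\sigma=f(w,T)$ and $\tau=\mathrm{ord}(\sigma)$. Then \[\mathrm{level}(w,T)=\sum_{c\in\mathrm{Des}(\sigma)}\mathrm{arm}(c)=\mathrm{charge}(\mathrm{cw}_2(\tau)).\]
   Context: Setting (type $A_{n-1}$): permutations in $S_n$ in one-line notation; $\ell$ = number of inversions; $<$ is Bruhat order. For $1\le i<j\le n$, $(i,j)$ is the root $\varepsilon_i-\varepsilon_j$ and the transposition $t_{ij}$ (right multiplication swaps positions $i,j$). For $1\le k\le n-1$, $\Gamma(k)=((1,n),\dots,(1,k+1),(2,n),\dots,(2,k+1),\dots,(k,n),\dots,(k,k+1))$. $\Gamma=\Gamma^{\mu_1}\cdots\Gamma^1=(\beta_1,\dots,\beta_m)$ with $\Gamma^j=\Gamma(\mu'_j)$ ($\mu'$ the conjugate partition). The affine level of position $i$ is $l_i=\#\{j\le i:\beta_j=\beta_i\}$. Folding pair $(w,J)$: $w\in S_n$, $J=\{j_1<\dots<j_s\}\subseteq\{1,\dots,m\}$, $w_i=w\beta_{j_1}\cdots\beta_{j_i}$, $\mathrm{end}(w,J)=w_s$; $j_i$ is a negative folding if $w_{i-1}<w_i$; $J^-$ = set of negative foldings; $\mathrm{level}(w,J)=\sum_{j\in J^-}l_j$. With $\langle\rho,(a,b)^\vee\rangle=b-a$, $\overline{\mathcal F}(\mu)$ is the set of folding pairs with $\frac12(\ell(w)+\ell(\mathrm{end}(w,J))-\#J)+\sum_{j\in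 J^-}\langle\rho,\beta_j^\vee\rangle=0$. $J$ is identified with the subsequence $T=T^{\mu_1}\cdots T^1$ of $\Gamma$ ($T^j$ the part in $\Gamma^j$). With $\pi^j=wT^{\mu_1}\cdots T^{j+1}$, the filling $f(w,T)=C^{\mu_1}\cdots C^1$ of the Young diagram of $\mu$ has column $C^j=\pi^j(1)\cdots\pi^j(\mu'_j)$ (top to bottom), columns displayed left to right as $C^{\mu_1},\dots,C^1$ (shortest to longest); $C^j(i)$ is the entry in row $i$. $\mathrm{ord}$ sorts each column increasingly. Descents: a cell in row $i$ of column $C^j$ is a descent if $C^{j+1}$ exists and has a row $i$, and $C^j(i)>C^{j+1}(i)$; $\mathrm{Des}(\sigma)$ is the set of descents. $\mathrm{arm}(c)$ is the number of cells to the left of $c$ in its row. Charge word: for a filling $\tau$ with columns numbered $1,2,\dots$ from longest to shortest (so $C^j$ has number $j$), $\mathrm{cw}(\tau)$ is the biword with one biletter $\binom{k}{j}$ for each entry $k$ in column $j$, biletters ordered by decreasing $k$ and, for equal $k$, by decreasing $j$; $\mathrm{cw}_2(\tau)$ is the word of lower letters. Charge (Lascoux–Schützenberger) of a word $v$ over $\{1,\dots,n\}$ with partition content (at least as many $j$'s as $(j+1)$'s): scan $v$ from its right end and select letters $1,2,\dots$ in order up to the largest possible $k$: select the rightmost $1$; after selecting $j$, select the first (nearest) unselected $j+1$ to the left of the selected $j$; if there is none, select the rightmost $j+1$ and add $k-j$ to the charge. Then remove the selected letters and repeat until the word is empty; $\mathrm{charge}(v)$ is the total sum. *)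

theory Defs
  imports Complex_Main "HOL-Combinatorics.Permutations" "HOL-Library.Product_Lexorder"
begin

text \<open>
  Permutations in \<open>S\<^sub>n\<close> are functions \<open>w\<close> with \<open>w permutes {1..n}\<close>, with one-line
  notation \<open>w 1, \<dots>, w n\<close>. The pair \<open>(a, b)\<close> with \<open>a < b\<close> stands both for the root
  \<open>\<epsilon>\<^sub>a - \<epsilon>\<^sub>b\<close> and for the transposition of \<open>a\<close> and \<open>b\<close>; right multiplication by it
  swaps the entries in positions \<open>a\<close> and \<open>b\<close>.
\<close>

type_synonym root = "nat \<times> nat"

definition perm_length :: "nat \<Rightarrow> (nat \<Rightarrow> nat) \<Rightarrow> nat" where
  "perm_length n w = card {(i, j). 1 \<le> i \<and> i < j \<and> j \<le> n \<and> w i > w j}"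

definition mult_root :: "(nat \<Rightarrow> nat) \<Rightarrow> root \<Rightarrow> (nat \<Rightarrow> nat)" where
  "mult_root w r = w \<circ> Transposition.transpose (fst r) (snd r)"

definition mult_roots :: "(nat \<Rightarrow> nat) \<Rightarrow> root list \<Rightarrow> (nat \<Rightarrow> nat)" where
  "mult_roots w rs = foldl mult_root w rs"

definition bruhat_step :: "nat \<Rightarrow> (nat \<Rightarrow> nat) \<Rightarrow> (nat \<Rightarrow> nat) \<Rightarrow> bool" where
  "bruhat_step n u v \<longleftrightarrow>
     (\<exists>a b. 1 \<le> a \<and> a < b \<and> b \<le> n \<and> v = mult_root u (a, b) \<and> perm_length n u < perm_length n v)"

definition bruhat_less :: "nat \<Rightarrow> (nat \<Rightarrow> nat) \<Rightarrow> (nat \<Rightarrow> nat) \<Rightarrow> bool" where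
  "bruhat_less n = (bruhat_step n)\<^sup>+\<^sup>+"

text \<open>
  A partition is a sequence \<open>\<mu> 1 \<ge> \<mu> 2 \<ge> \<dots>\<close> that is eventually zero; the value
  \<open>\<mu> 0\<close> is irrelevant.
\<close>

definition is_partition :: "(nat \<Rightarrow> nat) \<Rightarrow> bool" where
  "is_partition \<mu> \<longleftrightarrow> (\<forall>i\<ge>1. \<mu> (Suc i) \<le> \<mu> i) \<and> finite {i. 1 \<le> i \<and> \<mu> i \<noteq> 0}"

definition conj_part :: "(nat \<Rightarrow> nat) \<Rightarrow> nat \<Rightarrow> nat" where
  "conj_part \<mu> j = card {i. 1 \<le> i \<and> j \<le> \<mu> i}"

definition Gamma_block :: "nat \<Rightarrow> nat \<Rightarrow> root list" where
  "Gamma_block n k = concat (map (\<lambda>i. map (\<lambda>j. (i, j)) (rev [k + 1..<n + 1])) [1..<k + 1])"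

text \<open>\<open>Gamma_from n \<mu> j\<close> is the initial segment \<open>\<Gamma>\<^sup>p \<Gamma>\<^sup>p\<^sup>-\<^sup>1 \<cdots> \<Gamma>\<^sup>j\<close> with \<open>p = \<mu> 1\<close>.\<close>

definition Gamma_from :: "nat \<Rightarrow> (nat \<Rightarrow> nat) \<Rightarrow> nat \<Rightarrow> root list" where
  "Gamma_from n \<mu> j = concat (map (\<lambda>i. Gamma_block n (conj_part \<mu> i)) (rev [j..<\<mu> 1 + 1]))"

definition Gamma_chain :: "nat \<Rightarrow> (nat \<Rightarrow> nat) \<Rightarrow> root list" where
  "Gamma_chain n \<mu> = Gamma_from n \<mu> 1"

definition chain_root :: "nat \<Rightarrow> (nat \<Rightarrow> nat) \<Rightarrow> nat \<Rightarrow> root" where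
  "chain_root n \<mu> i = Gamma_chain n \<mu> ! (i - 1)"

definition affine_level :: "nat \<Rightarrow> (nat \<Rightarrow> nat) \<Rightarrow> nat \<Rightarrow> nat" where
  "affine_level n \<mu> i = card {j. 1 \<le> j \<and> j \<le> i \<and> chain_root n \<mu> j = chain_root n \<mu> i}"

definition folding_pairs :: "nat \<Rightarrow> (nat \<Rightarrow> nat) \<Rightarrow> ((nat \<Rightarrow> nat) \<times> nat set) set" where
  "folding_pairs n \<mu> = {(w, J). w permutes {1..n} \<and> J \<subseteq> {1..length (Gamma_chain n \<mu>)}}"

text \<open>\<open>fold_perm n \<mu> w J i\<close> is \<open>w\<^sub>i = w \<beta>\<^bsub>j\<^sub>1\<^esub> \<cdots> \<beta>\<^bsub>j\<^sub>i\<^esub>\<close>.\<close>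

definition fold_perm :: "nat \<Rightarrow> (nat \<Rightarrow> nat) \<Rightarrow> (nat \<Rightarrow> nat) \<Rightarrow> nat set \<Rightarrow> nat \<Rightarrow> (nat \<Rightarrow> nat)" where
  "fold_perm n \<mu> w J i =
     mult_roots w (map (chain_root n \<mu>) (take i (sorted_list_of_set J)))"

definition end_perm :: "nat \<Rightarrow> (nat \<Rightarrow> nat) \<Rightarrow> (nat \<Rightarrow> nat) \<Rightarrow> nat set \<Rightarrow> (nat \<Rightarrow> nat)" where
  "end_perm n \<mu> w J = fold_perm n \<mu> w J (card J)"

definition neg_foldings :: "nat \<Rightarrow> (nat \<Rightarrow> nat) \<Rightarrow> (nat \<Rightarrow> nat) \<Rightarrow> nat set \<Rightarrow> nat set" where
  "neg_foldings n \<mu> w J =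
     {sorted_list_of_set J ! (i - 1) | i. 1 \<le> i \<and> i \<le> card J \<and>
        bruhat_less n (fold_perm n \<mu> w J (i - 1)) (fold_perm n \<mu> w J i)}"

definition level :: "nat \<Rightarrow> (nat \<Rightarrow> nat) \<Rightarrow> (nat \<Rightarrow> nat) \<Rightarrow> nat set \<Rightarrow> nat" where
  "level n \<mu> w J = (\<Sum>j\<in>neg_foldings n \<mu> w J. affine_level n \<mu> j)"

definition rho_coroot :: "root \<Rightarrow> real" where
  "rho_coroot r = real (snd r) - real (fst r)"

definition F_bar :: "nat \<Rightarrow> (nat \<Rightarrow> nat) \<Rightarrow> ((nat \<Rightarrow> nat) \<times> nat set) set" where
  "F_bar n \<mu> = {(w, J) \<in> folding_pairs n \<mu>.
     (1 / 2) * (real (perm_length n w) + real (perm_length n (end_perm n \<mu> w J)) - real (card J))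
       + (\<Sum>j\<in>neg_foldings n \<mu> w J. rho_coroot (chain_root n \<mu> j)) = 0}"

text \<open>
  \<open>T_block n \<mu> J j\<close> is \<open>T\<^sup>j\<close>, the part of the subsequence of \<open>\<Gamma>\<close> indexed by \<open>J\<close> that lies
  in \<open>\<Gamma>\<^sup>j\<close>; the latter occupies the positions after \<open>Gamma_from n \<mu> (j + 1)\<close> up to the
  end of \<open>Gamma_from n \<mu> j\<close>.
\<close>

definition T_block :: "nat \<Rightarrow> (nat \<Rightarrow> nat) \<Rightarrow> nat set \<Rightarrow> nat \<Rightarrow> root list" where
  "T_block n \<mu> J j = map (chain_root n \<mu>) (sorted_list_of_set
     (J \<inter> {length (Gamma_from n \<mu> (j + 1))<..length (Gamma_from n \<mu> j)}))"

definition column_perm :: "nat \<Rightarrow> (nat \<Rightarrow> nat) \<Rightarrow> (nat \<Rightarrow> nat) \<Rightarrow> nat set \<Rightarrow> nat \<Rightarrow> (nat \<Rightarrow> nat)" where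
  "column_perm n \<mu> w J j = mult_roots w (concat (map (T_block n \<mu> J) (rev [j + 1..<\<mu> 1 + 1])))"

text \<open>
  A filling of the Young diagram of \<open>\<mu>\<close> maps \<open>j \<in> {1..\<mu> 1}\<close> to its column \<open>C\<^sup>j\<close>, read from
  top to bottom. The cell \<open>(j, i)\<close> is the one in row \<open>i\<close> of \<open>C\<^sup>j\<close>; as the columns
  are displayed from shortest to longest, column \<open>j'\<close> is to the left of column \<open>j\<close> iff \<open>j' > j\<close>.
\<close>

type_synonym filling = "nat \<Rightarrow> nat list"

definition fill_map :: "nat \<Rightarrow> (nat \<Rightarrow> nat) \<Rightarrow> (nat \<Rightarrow> nat) \<Rightarrow> nat set \<Rightarrow> filling" where
  "fill_map n \<mu> w J j = map (column_perm n \<mu> w J j) [1..<conj_part \<mu> j + 1]"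

definition entry :: "filling \<Rightarrow> nat \<Rightarrow> nat \<Rightarrow> nat" where
  "entry \<sigma> j i = \<sigma> j ! (i - 1)"

definition ord_filling :: "filling \<Rightarrow> filling" where
  "ord_filling \<sigma> j = sort (\<sigma> j)"

definition cells :: "(nat \<Rightarrow> nat) \<Rightarrow> (nat \<times> nat) set" where
  "cells \<mu> = {(j, i). 1 \<le> j \<and> j \<le> \<mu> 1 \<and> 1 \<le> i \<and> i \<le> conj_part \<mu> j}"

definition descents :: "(nat \<Rightarrow> nat) \<Rightarrow> filling \<Rightarrow> (nat \<times> nat) set" where
  "descents \<mu> \<sigma> =
     {(j, i). (j, i) \<in> cells \<mu> \<and> (j + 1, i) \<in> cells \<mu> \<and> entry \<sigma> j i > entry \<sigma> (j + 1) i}"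

definition arm :: "(nat \<Rightarrow> nat) \<Rightarrow> nat \<times> nat \<Rightarrow> nat" where
  "arm \<mu> c = card {c' \<in> cells \<mu>. snd c' = snd c \<and> fst c' > fst c}"

text \<open>The order on biletters \<open>(k, j)\<close> is lexicographic.\<close>

definition charge_biword :: "(nat \<Rightarrow> nat) \<Rightarrow> filling \<Rightarrow> (nat \<times> nat) list" where
  "charge_biword \<mu> \<tau> =
     rev (sort (concat (map (\<lambda>j. map (\<lambda>k. (k, j)) (\<tau> j)) [1..<\<mu> 1 + 1])))"

definition cw2 :: "(nat \<Rightarrow> nat) \<Rightarrow> filling \<Rightarrow> nat list" where
  "cw2 \<mu> \<tau> = map snd (charge_biword \<mu> \<tau>)"

text \<open>
  One pass of the charge algorithm on a word \<open>v\<close> (positions counted from \<open>0\<close>):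
  \<open>selected v j\<close> is the position of the selected letter \<open>j\<close>, for \<open>1 \<le> j \<le> max_letter v\<close>.
  The value at \<open>0\<close> is a sentinel at the right end, from which the nearest \<open>1\<close> to
  the left is the rightmost \<open>1\<close>.
\<close>

definition max_letter :: "nat list \<Rightarrow> nat" where
  "max_letter v = Max {k. {1..k} \<subseteq> set v}"

definition occurrences_left :: "nat list \<Rightarrow> nat \<Rightarrow> nat \<Rightarrow> nat set" where
  "occurrences_left v p a = {q. q < p \<and> q < length v \<and> v ! q = a}"

primrec selected :: "nat list \<Rightarrow> nat \<Rightarrow> nat" where
  "selected v 0 = length v"
| "selected v (Suc j) =
     (if occurrences_left v (selected v j) (Suc j) \<noteq> {}
      then Max (occurrences_left v (selected v j) (Suc j))
      else Max (occurrences_left v (length v) (Suc j)))"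

definition pass_charge :: "nat list \<Rightarrow> nat" where
  "pass_charge v = (\<Sum>j\<in>{1..<max_letter v}.
     if occurrences_left v (selected v j) (Suc j) = {} then max_letter v - j else 0)"

definition pass_rest :: "nat list \<Rightarrow> nat list" where
  "pass_rest v = nths v (- (selected v ` {1..max_letter v}))"

lemma pass_rest_shorter:
  assumes "max_letter v \<noteq> 0"
  shows "length (pass_rest v) < length v"
proof -
  have fin: "finite {k. {1..k} \<subseteq> set v}"
  proof (rule finite_subset)
    show "{k. {1..k} \<subseteq> set v} \<subseteq> {..card (set v)}"
    proof
      fix k assume "k \<in> {k. {1..k} \<subseteq> set v}"
      then have "card {1..k} \<le> card (set v)" by (intro card_mono) auto
      then show "k \<in> {..card (set v)}" by simp
    qed
  qed simp
  have "max_letter v \<in> {k. {1..k} \<subseteq> set v}"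
    unfolding max_letter_def
  proof (rule Max_in[OF fin])
    have "0 \<in> {k. {1..k} \<subseteq> set v}" by simp
    then show "{k. {1..k} \<subseteq> set v} \<noteq> {}" by blast
  qed
  with assms have "1 \<in> set v" by auto
  then have ne: "occurrences_left v (length v) 1 \<noteq> {}"
    by (auto simp: occurrences_left_def in_set_conv_nth)
  have "finite (occurrences_left v (length v) 1)"
    by (simp add: occurrences_left_def)
  from Max_in[OF this ne] ne have sel: "selected v 1 < length v"
    by (simp add: occurrences_left_def)
  have "length (pass_rest v) = card {i. i < length v \<and> i \<in> - (selected v ` {1..max_letter v})}"
    by (simp add: pass_rest_def length_nths)
  also have "\<dots> < card {..<length v}"
  proof (rule psubset_card_mono)
    have "selected v 1 \<in> selected v ` {1..max_letter v}"
      by (rule imageI) (use assms in simp)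
    with sel show "{i. i < length v \<and> i \<in> - (selected v ` {1..max_letter v})} \<subset> {..<length v}"
      by blast
  qed simp
  finally show ?thesis by simp
qed

text \<open>
  For words of partition content, \<open>max_letter v = 0\<close> holds exactly if \<open>v\<close> is empty.
\<close>

function charge :: "nat list \<Rightarrow> nat" where
  "charge v = (if max_letter v = 0 then 0 else pass_charge v + charge (pass_rest v))"
  by pat_completeness simp
termination
  by (relation "measure length") (simp_all add: pass_rest_shorter)

declare charge.simps [simp del]

end

theory Submission
  imports Defs
begin

text \<open>
  Every folding changes the length by at least one and at most \<open>2 \<langle>\<rho>, \<beta>\<^sup>\<or>\<rangle> - 1\<close>. The condition defining
  \<open>F_bar\<close> therefore forces the path to end at the identity and every folding to be a reversed edge
  of the quantum Bruhat graph. Such an edge \<open>(a, b)\<close> moves the entry in position \<open>a\<close> downwards in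
  the cyclic order on values without jumping over any entry in a position between \<open>a\<close> and \<open>b\<close>.
  Inside one block the foldings of row \<open>a\<close> have decreasing \<open>b\<close>, so together they never go once
  around the circle: row \<open>a\<close> has a negative folding, and then exactly one, iff its entry goes up,
  that is, iff there is a descent, and the affine level of that folding is the arm of the descent.
  Moreover no later entry of the old column lies cyclically between the new and the old entry of
  row \<open>a\<close>. Hence the entry of \<open>C\<^sup>j\<^sup>+\<^sup>1\<close> in row \<open>a\<close> is the first one met upwards from the entry of
  \<open>C\<^sup>j\<close>, among the rows from \<open>a\<close> on, and \<open>C\<^sup>1\<close> is increasing because the path ends at the identity.
  This is the selection rule of the charge algorithm, whose \<open>i\<close>-th pass thus removes row \<open>i\<close> of
  the filling and wraps around exactly at its descents.
\<close>

section \<open>Foldings and lengths\<close>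

definition good_root :: "nat \<Rightarrow> root \<Rightarrow> bool" where
  "good_root n r \<longleftrightarrow> 1 \<le> fst r \<and> fst r < snd r \<and> snd r \<le> n"

lemma mult_root_permutes:
  assumes "w permutes {1..n}" "good_root n r"
  shows "mult_root w r permutes {1..n}"
  unfolding mult_root_def
  by (rule permutes_compose[OF permutes_swap_id]) (use assms in \<open>auto simp: good_root_def\<close>)

lemma mult_roots_simps [simp]:
  "mult_roots w [] = w"
  "mult_roots w (r # rs) = mult_roots (mult_root w r) rs"
  "mult_roots w (rs @ rs') = mult_roots (mult_roots w rs) rs'"
  by (simp_all add: mult_roots_def)

lemma mult_roots_permutes:
  "w permutes {1..n} \<Longrightarrow> \<forall>r\<in>set rs. good_root n r \<Longrightarrow> mult_roots w rs permutes {1..n}"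
proof (induction rs arbitrary: w)
  case (Cons r rs)
  then show ?case using mult_root_permutes[of w n r] by simp
qed simp

lemma mult_root_apply [simp]:
  "mult_root w (a, b) a = w b" "mult_root w (a, b) b = w a"
  "c \<noteq> a \<Longrightarrow> c \<noteq> b \<Longrightarrow> mult_root w (a, b) c = w c"
  by (simp_all add: mult_root_def)

lemma mult_root_twice: "mult_root (mult_root w r) r = w"
  by (simp add: mult_root_def fun_eq_iff)

lemma mult_root_apply_if:
  "mult_root w (a, b) c = (if c = a then w b else if c = b then w a else w c)"
  by (simp add: mult_root_def transpose_def)

section \<open>Inversions under a transposition\<close>

definition inversions :: "nat \<Rightarrow> (nat \<Rightarrow> nat) \<Rightarrow> (nat \<times> nat) set" where
  "inversions n w = {(i, j). 1 \<le> i \<and> i < j \<and> j \<le> n \<and> w i > w j}"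

lemma finite_inversions: "finite (inversions n w)"
  by (rule finite_subset[of _ "{1..n} \<times> {1..n}"]) (auto simp: inversions_def)

text \<open>The map \<open>f\<close> injects the old inversions into the new ones: an inversion
  moves along with the transposition unless this would reverse its two positions, and in that case
  it survives in place. The new inversions not reached are \<open>(a, b)\<close> itself and, for
  each position \<open>c\<close> in \<open>M\<close>, the pairs \<open>(a, c)\<close> and
  \<open>(c, b)\<close>.\<close>

lemma perm_length_mult_root_up:
  assumes w: "w permutes {1..n}" and ab: "1 \<le> a" "a < b" "b \<le> n" and lt: "w a < w b"
  shows "perm_length n (mult_root w (a, b)) =
    perm_length n w + 1 + 2 * card {c. a < c \<and> c < b \<and> w a < w c \<and> w c < w b}"
proof -
  define M where "M = {c. a < c \<and> c < b \<and> w a < w c \<and> w c < w b}"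
  define t where "t = Transposition.transpose a b"
  define f where "f = (\<lambda>(i, j). if t i < t j then (t i, t j) else (i, j))"
  have finM: "finite M" by (rule finite_subset[of _ "{..b}"]) (auto simp: M_def)
  have inj: "w i = w j \<longleftrightarrow> i = j" for i j using permutes_inj[OF w] by (auto dest: injD)
  let ?N = "insert (a, b) ({a} \<times> M \<union> M \<times> {b})"
  have inj_f: "inj_on f (inversions n w)"
    by (auto simp: inj_on_def f_def t_def inversions_def transpose_def split: if_splits)
  have eq: "inversions n (mult_root w (a, b)) = f ` inversions n w \<union> ?N"
  proof (intro subset_antisym subrelI)
    fix i j assume ij: "(i, j) \<in> inversions n (mult_root w (a, b))"
    show "(i, j) \<in> f ` inversions n w \<union> ?N"
    proof (cases "(i, j) \<in> ?N")
      case False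
      have "\<exists>p \<in> inversions n w. (i, j) = f p"
      proof (cases "t i < t j")
        case True
        have "(t i, t j) \<in> inversions n w"
          using ij ab True by (auto simp: inversions_def t_def mult_root_def transpose_def split: if_splits)
        moreover have "f (t i, t j) = (i, j)"
          using ij by (auto simp: f_def t_def inversions_def)
        ultimately show ?thesis by metis
      next
        case nlt: False
        have "(i, j) \<in> inversions n w"
          using ij ab lt nlt False inj[of i a] inj[of j a] inj[of i b] inj[of j b]
          by (auto simp: inversions_def t_def mult_root_apply_if M_def transpose_def split: if_splits)
        moreover have "f (i, j) = (i, j)" using nlt by (simp add: f_def)
        ultimately show ?thesis by metis
      qed
      then show ?thesis by blast
    qed blast
  next
    fix i j assume "(i, j) \<in> f ` inversions n w \<union> ?N"
    then show "(i, j) \<in> inversions n (mult_root w (a, b))"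
    proof
      assume "(i, j) \<in> ?N"
      then show ?thesis using ab lt by (auto simp: inversions_def mult_root_apply_if M_def)
    next
      assume "(i, j) \<in> f ` inversions n w"
      then show ?thesis using ab lt
        by (auto simp: inversions_def mult_root_apply_if f_def t_def transpose_def split: if_splits)
    qed
  qed
  have disj: "f ` inversions n w \<inter> ?N = {}"
    using ab lt by (auto simp: inversions_def M_def f_def t_def transpose_def split: if_splits)
  have "card ({a} \<times> M \<union> M \<times> {b}) = 2 * card M"
    using finM by (subst card_Un_disjoint) (auto simp: M_def)
  moreover have "(a, b) \<notin> {a} \<times> M \<union> M \<times> {b}" by (auto simp: M_def)
  ultimately have "card ?N = 1 + 2 * card M" using finM by simp
  then have "card (inversions n (mult_root w (a, b))) = card (inversions n w) + (1 + 2 * card M)"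
    unfolding eq using finM disj by (subst card_Un_disjoint) (auto simp: finite_inversions card_image[OF inj_f])
  then show ?thesis by (simp add: perm_length_def inversions_def M_def)
qed

text \<open>The transposition is an involution, so this is the rising case read backwards from the
  product to \<open>w\<close>.\<close>

lemma perm_length_mult_root_down:
  assumes w: "w permutes {1..n}" and ab: "1 \<le> a" "a < b" "b \<le> n" and lt: "w b < w a"
  shows "perm_length n w = perm_length n (mult_root w (a, b)) + 1
     + 2 * card {c. a < c \<and> c < b \<and> w b < w c \<and> w c < w a}"
proof -
  let ?w = "mult_root w (a, b)"
  have "{c. a < c \<and> c < b \<and> ?w a < ?w c \<and> ?w c < ?w b} = {c. a < c \<and> c < b \<and> w b < w c \<and> w c < w a}"
    by (auto simp: mult_root_apply_if)
  then show ?thesis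
    using perm_length_mult_root_up[OF mult_root_permutes[OF w], of "(a, b)" a b] ab lt
    by (simp add: mult_root_twice good_root_def)
qed

section \<open>Bruhat order and length\<close>

lemma bruhat_less_length: "bruhat_less n u v \<Longrightarrow> perm_length n u < perm_length n v"
  unfolding bruhat_less_def by (induction rule: tranclp_induct) (auto simp: bruhat_step_def)

text \<open>Bruhat order strictly raises the length, and whether a transposition raises or lowers
  the length depends only on the two values it swaps. Negative foldings can thus be recognised from
  these values.\<close>

lemma bruhat_less_mult_root_iff:
  assumes w: "w permutes {1..n}" and r: "good_root n (a, b)"
  shows "bruhat_less n w (mult_root w (a, b)) \<longleftrightarrow> w a < w b"
proof
  assume "w a < w b"
  then have "perm_length n w < perm_length n (mult_root w (a, b))"
    using perm_length_mult_root_up[OF w, of a b] r by (auto simp: good_root_def)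
  then have "bruhat_step n w (mult_root w (a, b))"
    using r unfolding bruhat_step_def good_root_def by fastforce
  then show "bruhat_less n w (mult_root w (a, b))" by (simp add: bruhat_less_def)
next
  assume less: "bruhat_less n w (mult_root w (a, b))"
  have "w a \<noteq> w b" using permutes_inj[OF w] r by (auto simp: good_root_def dest: injD)
  moreover have "\<not> w b < w a"
    using bruhat_less_length[OF less] perm_length_mult_root_down[OF w, of a b] r
    by (auto simp: good_root_def)
  ultimately show "w a < w b" by simp
qed

text \<open>Without inversions \<open>w\<close> is increasing on \<open>{1..n}\<close>, hence
  \<open>i \<le> w i\<close>; both sides have the same sum, so equality holds throughout.\<close>

lemma perm_length_zero_imp_id:
  assumes w: "w permutes {1..n}" and "perm_length n w = 0"
  shows "w = id"
proof -
  have "inversions n w = {}"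
    using assms finite_inversions[of n w] by (simp add: perm_length_def inversions_def)
  then have mono: "w i < w j" if "1 \<le> i" "i < j" "j \<le> n" for i j
  proof -
    have "(i, j) \<notin> inversions n w" using \<open>inversions n w = {}\<close> by simp
    then have "w i \<le> w j" using that by (simp add: inversions_def)
    moreover have "w i \<noteq> w j" using permutes_inj[OF w] that by (auto dest: injD)
    ultimately show ?thesis by simp
  qed
  have ge: "i \<le> w i" if "1 \<le> i" "i \<le> n" for i
    using that
  proof (induction i rule: dec_induct)
    case base
    then show ?case using permutes_in_image[OF w, of 1] by simp
  next
    case (step i)
    then show ?case using mono[of i "Suc i"] by auto
  qed
  have "w i = i" if "i \<in> {1..n}" for i
  proof -
    have "(\<Sum>i\<in>{1..n}. w i) = (\<Sum>i\<in>{1..n}. i)"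
      using sum.permute[OF w, of "\<lambda>x. x"] by (simp add: o_def)
    then show ?thesis
      using sum_mono_inv[of "\<lambda>i. i" "{1..n}" w i] ge that by auto
  qed
  then show ?thesis using w by (auto simp: permutes_def fun_eq_iff)
qed

text \<open>The values met when descending cyclically from \<open>x\<close> (excluded) to \<open>y\<close> (included).\<close>

definition in_down :: "nat \<Rightarrow> nat \<Rightarrow> nat \<Rightarrow> bool" where
  "in_down x y z \<longleftrightarrow> (if y \<le> x then y \<le> z \<and> z < x else z < x \<or> y \<le> z)"

text \<open>
  A step is minimal if it is a reversed edge of the quantum Bruhat graph, that is, it lowers the
  length by one or raises it by the largest possible amount.
\<close>

definition min_step :: "(nat \<Rightarrow> nat) \<Rightarrow> root \<Rightarrow> bool" where
  "min_step w r \<longleftrightarrow>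
     (\<forall>c. fst r < c \<longrightarrow> c < snd r \<longrightarrow> \<not> in_down (w (fst r)) (w (snd r)) (w c))"

section \<open>Minimal paths and their negative steps\<close>

fun min_path :: "(nat \<Rightarrow> nat) \<Rightarrow> root list \<Rightarrow> bool" where
  "min_path w [] \<longleftrightarrow> True"
| "min_path w (r # rs) \<longleftrightarrow> min_step w r \<and> min_path (mult_root w r) rs"

lemma min_path_append [simp]:
  "min_path w (rs @ rs') \<longleftrightarrow> min_path w rs \<and> min_path (mult_roots w rs) rs'"
  by (induction rs arbitrary: w) auto

text \<open>Steps are labels read as roots through \<open>h\<close>. This serves indices in the
  chain, which carry affine levels, as well as bare roots, with \<open>h\<close> the
  identity.\<close>

fun neg_steps :: "('a \<Rightarrow> root) \<Rightarrow> (nat \<Rightarrow> nat) \<Rightarrow> 'a list \<Rightarrow> 'a list" where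
  "neg_steps h w [] = []"
| "neg_steps h w (x # xs) =
     (if w (fst (h x)) < w (snd (h x)) then [x] else []) @ neg_steps h (mult_root w (h x)) xs"

lemma neg_steps_append [simp]:
  "neg_steps h w (xs @ ys) = neg_steps h w xs @ neg_steps h (mult_roots w (map h xs)) ys"
  by (induction xs arbitrary: w) auto

lemma map_neg_steps: "map h (neg_steps h w xs) = neg_steps (\<lambda>r. r) w (map h xs)"
  by (induction xs arbitrary: w) auto

lemma set_neg_steps_subset: "set (neg_steps h w xs) \<subseteq> set xs"
  by (induction xs arbitrary: w) auto

lemma distinct_neg_steps: "distinct xs \<Longrightarrow> distinct (neg_steps h w xs)"
proof (induction xs arbitrary: w)
  case (Cons x xs)
  then show ?case using set_neg_steps_subset[of h "mult_root w (h x)" xs] by auto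
qed simp

lemma set_neg_steps_conv_nth:
  "set (neg_steps h w xs) = (!) xs ` {i. i < length xs \<and>
     mult_roots w (map h (take i xs)) (fst (h (xs ! i))) < mult_roots w (map h (take i xs)) (snd (h (xs ! i)))}"
proof (induction xs arbitrary: w)
  case (Cons x xs)
  have *: "{i. i < length (x # xs) \<and> P i} =
    (if P 0 then {0} else {}) \<union> Suc ` {i. i < length xs \<and> P (Suc i)}" for P
    by (auto simp: less_Suc_eq_0_disj)
  show ?case unfolding * by (simp add: Cons.IH image_image)
qed simp

text \<open>The drop exceeds one by twice the number of entries between the two positions with value
  strictly between \<open>w b\<close> and \<open>w a\<close>. If there are none, injectivity also
  excludes the value \<open>w b\<close>, the closed end of the arc in
  \<open>in_down\<close>.\<close>

lemma min_step_down:
  assumes w: "w permutes {1..n}" and r: "good_root n (a, b)" and lt: "w b < w a"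
  shows "perm_length n (mult_root w (a, b)) + 1 \<le> perm_length n w"
    and "perm_length n w = perm_length n (mult_root w (a, b)) + 1 \<Longrightarrow> min_step w (a, b)"
proof -
  let ?M = "{c. a < c \<and> c < b \<and> w b < w c \<and> w c < w a}"
  have len: "perm_length n w = perm_length n (mult_root w (a, b)) + 1 + 2 * card ?M"
    using perm_length_mult_root_down[OF w _ _ _ lt] r by (simp add: good_root_def)
  have fin: "finite ?M" by (rule finite_subset[of _ "{..b}"]) auto
  show "perm_length n (mult_root w (a, b)) + 1 \<le> perm_length n w" using len by simp
  assume "perm_length n w = perm_length n (mult_root w (a, b)) + 1"
  then have "?M = {}" using len fin by simp
  moreover have "w b \<noteq> w c" if "c < b" for c using permutes_inj[OF w] that by (auto dest: injD)
  ultimately show "min_step w (a, b)"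
    using lt by (fastforce simp: min_step_def in_down_def)
qed

text \<open>At most \<open>b - a - 1\<close> positions can contribute to the gain in length. If the
  bound is attained, every entry between the two positions has its value between \<open>w a\<close>
  and \<open>w b\<close>, so none lies on the arc that wraps around from \<open>w a\<close> down to
  \<open>w b\<close>.\<close>

lemma min_step_up:
  assumes w: "w permutes {1..n}" and r: "good_root n (a, b)" and lt: "w a < w b"
  shows "perm_length n (mult_root w (a, b)) + 1 \<le> perm_length n w + 2 * (b - a)"
    and "perm_length n (mult_root w (a, b)) + 1 = perm_length n w + 2 * (b - a) \<Longrightarrow> min_step w (a, b)"
proof -
  let ?M = "{c. a < c \<and> c < b \<and> w a < w c \<and> w c < w b}"
  have len: "perm_length n (mult_root w (a, b)) = perm_length n w + 1 + 2 * card ?M"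
    using perm_length_mult_root_up[OF w _ _ _ lt] r by (simp add: good_root_def)
  have sub: "?M \<subseteq> {a<..<b}" by auto
  then have le: "card ?M \<le> b - a - 1" using card_mono[OF _ sub] by simp
  moreover have "a < b" using r by (simp add: good_root_def)
  ultimately show "perm_length n (mult_root w (a, b)) + 1 \<le> perm_length n w + 2 * (b - a)"
    using len by simp
  assume "perm_length n (mult_root w (a, b)) + 1 = perm_length n w + 2 * (b - a)"
  then have "card ?M = card {a<..<b}" using len by simp
  then have eq: "?M = {a<..<b}" using card_subset_eq[OF _ sub] by simp
  have "w a < w c \<and> w c < w b" if "a < c" "c < b" for c
  proof -
    have "c \<in> ?M" unfolding eq using that by simp
    then show ?thesis by simp
  qed
  then show "min_step w (a, b)" using lt by (force simp: min_step_def in_down_def)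
qed

text \<open>\<open>E\<close> telescopes into one defect per step: the drop in length minus one for a
  falling step, and \<open>2 * rho_coroot - 1\<close> minus the gain for a rising one. No defect is
  negative, so \<open>E = 0\<close> makes all of them vanish, and a step without defect is
  minimal.\<close>

lemma min_path_of_length:
  fixes h :: "'a \<Rightarrow> root"
  assumes "w permutes {1..n}" and "\<forall>x\<in>set xs. good_root n (h x)"
  defines "E \<equiv> real (perm_length n w) - real (perm_length n (mult_roots w (map h xs))) - real (length xs)
      + 2 * (\<Sum>x\<leftarrow>neg_steps h w xs. rho_coroot (h x))"
  shows "E \<ge> 0 \<and> (E = 0 \<longrightarrow> min_path w (map h xs))"
  unfolding E_def using assms(1,2)
proof (induction xs arbitrary: w)
  case (Cons x xs)
  obtain a b where h: "h x = (a, b)" by (cases "h x")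
  let ?w = "mult_root w (a, b)"
  have r: "good_root n (a, b)" and ab: "a < b" using Cons.prems h by (auto simp: good_root_def)
  have IH: "real (perm_length n ?w) - real (perm_length n (mult_roots ?w (map h xs))) - real (length xs)
      + 2 * (\<Sum>x\<leftarrow>neg_steps h ?w xs. rho_coroot (h x)) \<ge> 0 \<and>
     (real (perm_length n ?w) - real (perm_length n (mult_roots ?w (map h xs))) - real (length xs)
      + 2 * (\<Sum>x\<leftarrow>neg_steps h ?w xs. rho_coroot (h x)) = 0 \<longrightarrow> min_path ?w (map h xs))"
    using Cons.IH[of ?w] Cons.prems mult_root_permutes[OF Cons.prems(1) r] by auto
  have "w a \<noteq> w b" using permutes_inj[OF Cons.prems(1)] ab by (auto dest: injD)
  then consider "w a < w b" | "w b < w a" by linarith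
  then show ?case
  proof cases
    case 1
    have le: "real (perm_length n ?w) + 1 \<le> real (perm_length n w) + 2 * rho_coroot (a, b)"
      and eq: "real (perm_length n ?w) + 1 = real (perm_length n w) + 2 * rho_coroot (a, b) \<Longrightarrow> min_step w (a, b)"
      using min_step_up[OF Cons.prems(1) r 1] ab unfolding rho_coroot_def by (auto simp: of_nat_diff)
    show ?thesis using IH le eq 1 by (auto simp: h)
  next
    case 2
    have le: "real (perm_length n ?w) + 1 \<le> real (perm_length n w)"
      and eq: "real (perm_length n ?w) + 1 = real (perm_length n w) \<Longrightarrow> min_step w (a, b)"
      using min_step_down[OF Cons.prems(1) r 2] by auto
    show ?thesis using IH le eq 2 by (auto simp: h)
  qed
qed simp

section \<open>Rows and blocks of a folding path\<close>

text \<open>The order in which a block of the chain lists its roots.\<close>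

definition root_before :: "root \<Rightarrow> root \<Rightarrow> bool" where
  "root_before r s \<longleftrightarrow> fst r < fst s \<or> fst r = fst s \<and> snd s < snd r"

lemma mult_roots_fixed:
  "\<forall>r\<in>set rs. fst r \<noteq> c \<and> snd r \<noteq> c \<Longrightarrow> mult_roots w rs c = w c"
proof (induction rs arbitrary: w)
  case (Cons r rs)
  then show ?case by (cases r) auto
qed simp

text \<open>As the second indices decrease, after the step at \<open>b\<close> row \<open>a\<close>
  can only receive entries from positions strictly between \<open>a\<close> and \<open>b\<close>,
  and minimality keeps these off the arc just swept from \<open>w a\<close> down to
  \<open>w b\<close>. The arcs of all steps therefore join up to the single arc from
  \<open>w a\<close> down to \<open>v a\<close>, less than a full turn: at most one step wraps
  around, and no entry of the rows after \<open>a\<close> up to \<open>k\<close> is met.\<close>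

lemma min_path_row:
  assumes "inj w" "sorted_wrt (>) bs" "\<forall>b\<in>set bs. k < b" "a \<le> k"
    and "min_path w (map (Pair a) bs)"
  defines "v \<equiv> mult_roots w (map (Pair a) bs)"
  shows "v a \<in> w ` insert a (set bs) \<and>
    length (neg_steps (\<lambda>r. r) w (map (Pair a) bs)) = of_bool (w a < v a) \<and>
    (\<forall>l. a < l \<and> l \<le> k \<longrightarrow> \<not> in_down (w a) (v a) (w l))"
  unfolding v_def using assms(1-5)
proof (induction bs arbitrary: w)
  case Nil
  then show ?case by (simp add: in_down_def)
next
  case (Cons b bs)
  let ?w = "mult_root w (a, b)"
  let ?v = "mult_roots ?w (map (Pair a) bs)"
  have ab: "a < b" "k < b" and bs: "\<forall>c\<in>set bs. k < c \<and> c < b" using Cons.prems by auto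
  have "inj ?w" using Cons.prems(1) by (simp add: mult_root_def inj_compose)
  then have IH: "?v a \<in> ?w ` insert a (set bs)"
    "length (neg_steps (\<lambda>r. r) ?w (map (Pair a) bs)) = of_bool (w b < ?v a)"
    "\<And>l. a < l \<Longrightarrow> l \<le> k \<Longrightarrow> \<not> in_down (w b) (?v a) (?w l)"
    using Cons.IH[of ?w] Cons.prems by auto
  have step: "\<not> in_down (w a) (w b) (w c)" if "a < c" "c < b" for c
    using Cons.prems(5) that by (simp add: min_step_def)
  have inj: "w x = w y \<longleftrightarrow> x = y" for x y using Cons.prems(1) by (auto dest: injD)
  have image: "?v a \<in> w ` insert b (set bs)"
    using IH(1) bs Cons.prems(4) ab by (auto simp: mult_root_apply_if split: if_splits)
  \<comment> \<open>This rules out a full turn: the final entry is neither on the arc swept by the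
    first step nor equal to the starting value.\<close>
  have v: "?v a = w b \<or> \<not> in_down (w a) (w b) (?v a) \<and> ?v a \<noteq> w a \<and> ?v a \<noteq> w b"
    using image
  proof
    fix c assume c: "?v a = w c" "c \<in> insert b (set bs)"
    show ?thesis
    proof (cases "c = b")
      case False
      then have "a < c" "c < b" using c bs Cons.prems(4) by auto
      then show ?thesis using step[of c] c(1) inj by auto
    qed (use c in simp)
  qed
  have neq: "w a \<noteq> w b" using inj ab by simp
  have "\<not> in_down (w a) (?v a) (w l)" if "a < l" "l \<le> k" for l
  proof -
    have "?w l = w l" using that ab by simp
    then show ?thesis
      using IH(3)[OF that] step[of l] that ab v neq
      by (auto simp: in_down_def split: if_splits)
  qed
  \<comment> \<open>A rise means wrapping around. The joined arc wraps iff one of its two pieces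
    does, and both cannot.\<close>
  moreover have "of_bool (w a < w b) + of_bool (w b < ?v a) = (of_bool (w a < ?v a) :: nat)"
    using v neq by (auto simp: in_down_def split: if_splits)
  ultimately show ?case using image IH(2) by auto
qed

text \<open>Isolates the steps of one row so that \<open>min_path_row\<close> applies: in this order
  the roots of a row are contiguous.\<close>

lemma sorted_wrt_root_split:
  assumes "sorted_wrt root_before T"
  obtains T1 bs T2 where "T = T1 @ map (Pair i) bs @ T2" "sorted_wrt (>) bs"
    "\<forall>r\<in>set T1. fst r < i" "\<forall>r\<in>set T2. i < fst r"
proof -
  have "\<exists>T1 bs T2. T = T1 @ map (Pair i) bs @ T2 \<and> sorted_wrt (>) bs \<and>
    (\<forall>r\<in>set T1. fst r < i) \<and> (\<forall>r\<in>set T2. i < fst r)"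
    using assms
  proof (induction T)
    case Nil
    show ?case by (rule exI[of _ "[]"])+ simp
  next
    case (Cons r T)
    then obtain T1 bs T2 where T: "T = T1 @ map (Pair i) bs @ T2" "sorted_wrt (>) bs"
      "\<forall>r\<in>set T1. fst r < i" "\<forall>r\<in>set T2. i < fst r" by auto
    have before: "\<forall>s\<in>set T. root_before r s" using Cons.prems by simp
    consider "fst r < i" | "fst r = i" | "i < fst r" by linarith
    then show ?case
    proof cases
      case 1
      then show ?thesis using T by (intro exI[of _ "r # T1"] exI[of _ bs] exI[of _ T2]) auto
    next
      case 2
      then have "T1 = []" using before T by (cases T1) (auto simp: root_before_def)
      moreover have "b < snd r" if "b \<in> set bs" for b
      proof -
        have "(i, b) \<in> set T" using T(1) that by simp
        then show ?thesis using before 2 by (auto simp: root_before_def)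
      qed
      ultimately show ?thesis using T 2
        by (intro exI[of _ "[]"] exI[of _ "snd r # bs"] exI[of _ T2]) auto
    next
      case 3
      then have "T1 = []" using before T by (cases T1) (auto simp: root_before_def)
      moreover have "bs = []" using before T 3 by (cases bs) (auto simp: root_before_def)
      ultimately show ?thesis using T 3
        by (intro exI[of _ "[]"] exI[of _ "[]"] exI[of _ "r # T2"]) auto
    qed
  qed
  then show ?thesis using that by blast
qed

text \<open>Every root of the block joins a row up to \<open>k\<close> to a position beyond
  \<open>k\<close>. Steps of earlier rows thus leave the rows \<open>i\<close> to \<open>k\<close>
  alone, and steps of later rows leave the rows up to \<open>i\<close> alone, so the whole history
  of row \<open>i\<close> is its own segment. The permutation \<open>u\<close> is the state just
  before this segment.\<close>

lemma min_path_block: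
  assumes w: "w permutes {1..n}" and T: "sorted_wrt root_before T"
    and roots: "\<forall>r\<in>set T. 1 \<le> fst r \<and> fst r \<le> k \<and> k < snd r \<and> snd r \<le> n"
    and path: "min_path w T" and i: "i \<le> k"
  shows "length (filter (\<lambda>r. fst r = i) (neg_steps (\<lambda>r. r) w T)) = of_bool (w i < mult_roots w T i)"
    and "i < l \<Longrightarrow> l \<le> k \<Longrightarrow> \<not> in_down (w i) (mult_roots w T i) (w l)"
    and "\<exists>u. u permutes {1..n} \<and> (\<forall>l. i \<le> l \<and> l \<le> k \<longrightarrow> u l = w l) \<and> (\<forall>l<i. u l = mult_roots w T l)"
proof -
  obtain T1 bs T2 where split: "T = T1 @ map (Pair i) bs @ T2" and bs: "sorted_wrt (>) bs"
    and T1: "\<forall>r\<in>set T1. fst r < i" and T2: "\<forall>r\<in>set T2. i < fst r"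
    using sorted_wrt_root_split[OF T, of i] by blast
  have snd: "\<forall>r\<in>set T1. k < snd r" "\<forall>b\<in>set bs. k < b" "\<forall>r\<in>set T2. k < snd r"
    using roots unfolding split by (auto simp: ball_Un)
  define u where "u = mult_roots w T1"
  define v where "v = mult_roots u (map (Pair i) bs)"
  have good: "\<forall>r\<in>set T1. good_root n r" using roots split by (force simp: good_root_def)
  have perm: "u permutes {1..n}" unfolding u_def by (rule mult_roots_permutes[OF w good])
  have u: "u l = w l" if "i \<le> l" "l \<le> k" for l
    unfolding u_def by (rule mult_roots_fixed) (use that T1 snd in auto)
  have end_eq: "mult_roots w T = mult_roots v T2" by (simp add: split u_def v_def)
  have v: "mult_roots w T l = v l" if "l \<le> i" for l
    unfolding end_eq by (rule mult_roots_fixed) (use that T2 snd i in auto)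
  have v_less: "v l = u l" if "l < i" for l
    unfolding v_def by (rule mult_roots_fixed) (use that snd i in auto)
  have "min_path u (map (Pair i) bs)" using path by (simp add: split u_def)
  then have row: "length (neg_steps (\<lambda>r. r) u (map (Pair i) bs)) = of_bool (u i < v i)"
    "\<And>l. i < l \<Longrightarrow> l \<le> k \<Longrightarrow> \<not> in_down (u i) (v i) (u l)"
    using min_path_row[OF permutes_inj[OF perm] bs snd(2) i] by (auto simp: v_def)
  have "filter (\<lambda>r. fst r = i) (neg_steps (\<lambda>r. r) w T1) = []"
    using set_neg_steps_subset[of "\<lambda>r. r" w T1] T1 by (auto simp: filter_empty_conv)
  moreover have "filter (\<lambda>r. fst r = i) (neg_steps (\<lambda>r. r) v T2) = []"
    using set_neg_steps_subset[of "\<lambda>r. r" v T2] T2 by (auto simp: filter_empty_conv)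
  moreover have "filter (\<lambda>r. fst r = i) (neg_steps (\<lambda>r. r) u (map (Pair i) bs)) = neg_steps (\<lambda>r. r) u (map (Pair i) bs)"
    using set_neg_steps_subset[of "\<lambda>r. r" u "map (Pair i) bs"] by (auto simp: filter_id_conv)
  ultimately have "filter (\<lambda>r. fst r = i) (neg_steps (\<lambda>r. r) w T) = neg_steps (\<lambda>r. r) u (map (Pair i) bs)"
    by (simp add: split u_def v_def)
  then show "length (filter (\<lambda>r. fst r = i) (neg_steps (\<lambda>r. r) w T)) = of_bool (w i < mult_roots w T i)"
    using row(1) u[of i] v[of i] i by simp
  show "\<not> in_down (w i) (mult_roots w T i) (w l)" if "i < l" "l \<le> k"
    using row(2)[OF that] u[of i] u[of l] v[of i] i that by simp
  show "\<exists>u. u permutes {1..n} \<and> (\<forall>l. i \<le> l \<and> l \<le> k \<longrightarrow> u l = w l) \<and> (\<forall>l<i. u l = mult_roots w T l)"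
    using perm u v v_less by (intro exI[of _ u]) auto
qed

lemma sum_list_fst_conv_sum:
  fixes h :: "nat \<Rightarrow> nat"
  assumes "\<forall>r\<in>set xs. fst r \<in> A" and "finite A"
  shows "(\<Sum>r\<leftarrow>xs. h (fst r)) = (\<Sum>i\<in>A. h i * length (filter (\<lambda>r. fst r = i) xs))"
  using assms(1)
proof (induction xs)
  case (Cons r xs)
  have "(\<Sum>i\<in>A. h i * length (filter (\<lambda>r. fst r = i) (r # xs))) =
    (\<Sum>i\<in>A. (if fst r = i then h i else 0) + h i * length (filter (\<lambda>r. fst r = i) xs))"
    by (rule sum.cong) auto
  also have "\<dots> = h (fst r) + (\<Sum>i\<in>A. h i * length (filter (\<lambda>r. fst r = i) xs))"
    using Cons.prems assms(2) by (simp add: sum.distrib)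
  finally show ?case using Cons by simp
qed simp

text \<open>A row has one negative step if its entry rises and none otherwise, so a weight that
  depends only on the row can be summed over the rising rows.\<close>

lemma neg_steps_weight:
  fixes h :: "nat \<Rightarrow> nat"
  assumes "w permutes {1..n}" and "sorted_wrt root_before T"
    and roots: "\<forall>r\<in>set T. 1 \<le> fst r \<and> fst r \<le> k \<and> k < snd r \<and> snd r \<le> n"
    and "min_path w T"
  shows "(\<Sum>r\<leftarrow>neg_steps (\<lambda>r. r) w T. h (fst r)) = (\<Sum>i\<in>{1..k}. if w i < mult_roots w T i then h i else 0)"
proof -
  have "\<forall>r\<in>set (neg_steps (\<lambda>r. r) w T). fst r \<in> {1..k}"
    using set_neg_steps_subset[of "\<lambda>r. r" w T] roots by auto
  then have "(\<Sum>r\<leftarrow>neg_steps (\<lambda>r. r) w T. h (fst r)) =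
    (\<Sum>i\<in>{1..k}. h i * length (filter (\<lambda>r. fst r = i) (neg_steps (\<lambda>r. r) w T)))"
    by (rule sum_list_fst_conv_sum) simp
  also have "\<dots> = (\<Sum>i\<in>{1..k}. if w i < mult_roots w T i then h i else 0)"
    using min_path_block(1)[OF assms] by (intro sum.cong) auto
  finally show ?thesis .
qed

text \<open>Just before row \<open>i\<close> is treated, the rows above it already hold their final
  values \<open>1\<close> to \<open>i - 1\<close>, so the entries of the rows \<open>i\<close> to
  \<open>k\<close> are at least \<open>i\<close>. Row \<open>i\<close> then descends from
  \<open>w i\<close> to \<open>i\<close> without passing any of the later ones, which must be larger
  than \<open>w i\<close>.\<close>

lemma min_path_to_id:
  assumes w: "w permutes {1..n}" and T: "sorted_wrt root_before T"
    and roots: "\<forall>r\<in>set T. 1 \<le> fst r \<and> fst r \<le> k \<and> k < snd r \<and> snd r \<le> n"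
    and path: "min_path w T" and "mult_roots w T = id" and i: "1 \<le> i" "i \<le> k" "k \<le> n"
  shows "i \<le> w i" and "i < l \<Longrightarrow> l \<le> k \<Longrightarrow> w i < w l"
proof -
  obtain u where u: "u permutes {1..n}" "\<And>l. i \<le> l \<Longrightarrow> l \<le> k \<Longrightarrow> u l = w l" "\<And>l. l < i \<Longrightarrow> u l = l"
    using min_path_block(3)[OF w T roots path i(2)] assms(5) by auto
  have ge: "i \<le> w l" if "i \<le> l" "l \<le> k" for l
  proof (rule ccontr)
    assume "\<not> i \<le> w l"
    \<comment> \<open>A position below \<open>i\<close> is fixed by \<open>u\<close>, so both sides
      are equal to \<open>w l\<close>.\<close>
    then have "u (w l) = u l" using u(2)[of l] u(3)[of "w l"] that by simp
    then have "w l = l" using permutes_inj[OF u(1)] by (auto dest: injD)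
    then show False using \<open>\<not> i \<le> w l\<close> that by simp
  qed
  show "i \<le> w i" using ge i by simp
  assume l: "i < l" "l \<le> k"
  have "\<not> in_down (w i) i (w l)" using min_path_block(2)[OF w T roots path i(2) l] assms(5) by simp
  moreover have "w i \<noteq> w l" using permutes_inj[OF w] l by (auto dest: injD)
  ultimately show "w i < w l" using ge[of i] ge[of l] l i by (auto simp: in_down_def split: if_splits)
qed

section \<open>Partitions and the chain of roots\<close>

lemma partition_antimono:
  assumes "is_partition \<mu>" "1 \<le> i" "i \<le> l"
  shows "\<mu> l \<le> \<mu> i"
  using assms(3)
proof (induction l rule: dec_induct)
  case (step l)
  have "\<mu> (Suc l) \<le> \<mu> l" using assms(1,2) step(1) by (simp add: is_partition_def)
  then show ?case using step by simp
qed simp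

lemma finite_conj_part:
  assumes "is_partition \<mu>" "1 \<le> j"
  shows "finite {i. 1 \<le> i \<and> j \<le> \<mu> i}"
  by (rule finite_subset[of _ "{i. 1 \<le> i \<and> \<mu> i \<noteq> 0}"]) (use assms in \<open>auto simp: is_partition_def\<close>)

lemma le_conj_part_iff:
  assumes "is_partition \<mu>" "1 \<le> i" "1 \<le> j"
  shows "i \<le> conj_part \<mu> j \<longleftrightarrow> j \<le> \<mu> i"
proof
  assume "j \<le> \<mu> i"
  then have "{1..i} \<subseteq> {i. 1 \<le> i \<and> j \<le> \<mu> i}"
    using partition_antimono[OF assms(1)] by (auto intro: order_trans)
  from card_mono[OF finite_conj_part[OF assms(1,3)] this] show "i \<le> conj_part \<mu> j"
    by (simp add: conj_part_def)
next
  assume i: "i \<le> conj_part \<mu> j"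
  show "j \<le> \<mu> i"
  proof (rule ccontr)
    assume "\<not> j \<le> \<mu> i"
    then have "{i. 1 \<le> i \<and> j \<le> \<mu> i} \<subseteq> {1..<i}"
      using partition_antimono[OF assms(1,2)] by (force simp: not_le[symmetric])
    from card_mono[OF _ this] show False using i assms(2) by (simp add: conj_part_def)
  qed
qed

lemma conj_part_less:
  assumes "is_partition \<mu>" "\<mu> n = 0" "1 \<le> n" "1 \<le> j"
  shows "conj_part \<mu> j < n"
  using le_conj_part_iff[OF assms(1,3,4)] assms by simp

lemma conj_part_antimono:
  assumes "is_partition \<mu>" "1 \<le> j" "j \<le> j'"
  shows "conj_part \<mu> j' \<le> conj_part \<mu> j"
  unfolding conj_part_def
  by (rule card_mono[OF finite_conj_part]) (use assms in auto)

section \<open>Order and multiplicity of the roots in the chain\<close>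

lemma sorted_wrt_root_before_rows:
  assumes "sorted_wrt (<) is" "sorted_wrt (>) bs"
  shows "sorted_wrt root_before (concat (map (\<lambda>i. map (Pair i) bs) is))"
  using assms(1)
proof (induction "is")
  case (Cons i "is")
  have "sorted_wrt root_before (map (Pair i) bs)"
    unfolding sorted_wrt_map using assms(2) by (simp add: root_before_def)
  moreover have "root_before (i, b) (l, b')" if "l \<in> set is" for b l b'
    using Cons.prems that by (simp add: root_before_def)
  ultimately show ?case using Cons by (auto simp: sorted_wrt_append)
qed simp

lemma sorted_Gamma_block: "sorted_wrt root_before (Gamma_block n k)"
  unfolding Gamma_block_def by (rule sorted_wrt_root_before_rows) (simp_all add: sorted_wrt_rev del: upt_Suc)

lemma set_Gamma_block: "set (Gamma_block n k) = {(a, b). 1 \<le> a \<and> a \<le> k \<and> k < b \<and> b \<le> n}"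
  unfolding Gamma_block_def by (auto simp del: upt_Suc) force

lemma distinct_Gamma_block: "distinct (Gamma_block n k)"
proof -
  have "sorted_wrt root_before rs \<Longrightarrow> distinct rs" for rs
    by (induction rs) (auto simp: root_before_def)
  then show ?thesis using sorted_Gamma_block by blast
qed

lemma Gamma_from_rec:
  assumes "j \<le> \<mu> 1"
  shows "Gamma_from n \<mu> j = Gamma_from n \<mu> (Suc j) @ Gamma_block n (conj_part \<mu> j)"
proof -
  have "[j..<\<mu> 1 + 1] = j # [Suc j..<\<mu> 1 + 1]" using assms by (simp add: upt_conv_Cons del: upt_Suc)
  then show ?thesis by (simp add: Gamma_from_def del: upt_Suc)
qed

lemma Gamma_from_end: "Gamma_from n \<mu> (Suc (\<mu> 1)) = []"
  by (simp add: Gamma_from_def)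

lemma Gamma_chain_prefix:
  assumes "1 \<le> j" "j \<le> Suc (\<mu> 1)"
  shows "\<exists>ys. Gamma_chain n \<mu> = Gamma_from n \<mu> j @ ys"
proof -
  have "[1..<\<mu> 1 + 1] = [1..<j] @ [j..<\<mu> 1 + 1]" 
    using assms upt_add_eq_append[of 1 j "\<mu> 1 + 1 - j"] by simp
  then show ?thesis by (simp add: Gamma_chain_def Gamma_from_def del: upt_Suc)
qed

text \<open>Positions in the chain count from 1 and positions in a list from 0, hence the shift by
  one besides the length of the preceding blocks.\<close>

lemma chain_root_block:
  assumes "1 \<le> j" "j \<le> \<mu> 1" and i: "i \<in> {length (Gamma_from n \<mu> (Suc j))<..length (Gamma_from n \<mu> j)}"
  shows "chain_root n \<mu> i = Gamma_block n (conj_part \<mu> j) ! (i - 1 - length (Gamma_from n \<mu> (Suc j)))"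
    and "i - 1 - length (Gamma_from n \<mu> (Suc j)) < length (Gamma_block n (conj_part \<mu> j))"
proof -
  have eq: "Gamma_from n \<mu> j = Gamma_from n \<mu> (Suc j) @ Gamma_block n (conj_part \<mu> j)"
    by (rule Gamma_from_rec[of j \<mu>, OF assms(2)])
  show less: "i - 1 - length (Gamma_from n \<mu> (Suc j)) < length (Gamma_block n (conj_part \<mu> j))"
    using i by (auto simp: eq)
  obtain ys where "Gamma_chain n \<mu> = Gamma_from n \<mu> j @ ys"
    using Gamma_chain_prefix[of j \<mu> n] assms by auto
  then show "chain_root n \<mu> i = Gamma_block n (conj_part \<mu> j) ! (i - 1 - length (Gamma_from n \<mu> (Suc j)))"
    using i less by (auto simp: chain_root_def eq nth_append)
qed

lemma chain_root_block_bounds: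
  assumes "1 \<le> j" "j \<le> \<mu> 1" "i \<in> {length (Gamma_from n \<mu> (Suc j))<..length (Gamma_from n \<mu> j)}"
  shows "1 \<le> fst (chain_root n \<mu> i) \<and> fst (chain_root n \<mu> i) \<le> conj_part \<mu> j \<and>
    conj_part \<mu> j < snd (chain_root n \<mu> i) \<and> snd (chain_root n \<mu> i) \<le> n"
proof -
  have "chain_root n \<mu> i \<in> set (Gamma_block n (conj_part \<mu> j))"
    using chain_root_block[of j \<mu> i n] assms by simp
  then show ?thesis unfolding set_Gamma_block by (auto simp: case_prod_unfold)
qed

text \<open>Columns shrink as their index grows, so the lower bound on \<open>b\<close> persists in
  every block from \<open>j\<close> on. Hence \<open>(a, b)\<close> occurs exactly once in each
  block whose column reaches row \<open>a\<close>, that is, in the blocks \<open>j\<close> to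
  \<open>\<mu> a\<close>; truncated subtraction covers \<open>j > \<mu> a\<close>.\<close>

lemma count_Gamma_from:
  assumes part: "is_partition \<mu>" and j: "1 \<le> j" "j \<le> Suc (\<mu> 1)"
    and ab: "1 \<le> a" "conj_part \<mu> j < b" "b \<le> n"
  shows "length (filter (\<lambda>r. r = (a, b)) (Gamma_from n \<mu> j)) = \<mu> a + 1 - j"
  using j(2,1) ab(2)
proof (induction j rule: inc_induct)
  case base
  then show ?case using partition_antimono[OF part, of 1 a] ab by (simp add: Gamma_from_end[simplified])
next
  case (step j)
  have "length (filter (\<lambda>r. r = (a, b)) (Gamma_block n (conj_part \<mu> j))) = of_bool ((a, b) \<in> set (Gamma_block n (conj_part \<mu> j)))"
    using distinct_length_filter[OF distinct_Gamma_block[of n "conj_part \<mu> j"], of "\<lambda>r. r = (a, b)"]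
    by (cases "(a, b) \<in> set (Gamma_block n (conj_part \<mu> j))") (auto simp: Int_def conj_commute Collect_conv_if filter_empty_conv)
  also have "\<dots> = of_bool (j \<le> \<mu> a)"
    using step ab le_conj_part_iff[OF part ab(1), of j] by (simp add: set_Gamma_block)
  finally show ?case
    using step conj_part_antimono[OF part, of j "Suc j"]
    by (subst Gamma_from_rec) auto
qed

text \<open>The root of row \<open>a\<close> has occurred once in each of the blocks from
  \<open>\<mu> a\<close> down to \<open>j\<close>, the last time at \<open>i\<close> itself. For
  \<open>j > 1\<close> the value is the arm of the cell in row \<open>a\<close> of column
  \<open>j - 1\<close>.\<close>

lemma affine_level_block:
  assumes part: "is_partition \<mu>" and j: "1 \<le> j" "j \<le> \<mu> 1"
    and i: "i \<in> {length (Gamma_from n \<mu> (Suc j))<..length (Gamma_from n \<mu> j)}"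
  shows "affine_level n \<mu> i = \<mu> (fst (chain_root n \<mu> i)) + 1 - j"
proof -
  define a b where "a = fst (chain_root n \<mu> i)" and "b = snd (chain_root n \<mu> i)"
  define q where "q = i - 1 - length (Gamma_from n \<mu> (Suc j))"
  let ?B = "Gamma_block n (conj_part \<mu> j)"
  have q: "?B ! q = (a, b)" "q < length ?B"
    using chain_root_block[of j \<mu>, OF j i] by (simp_all add: a_def b_def q_def)
  have ab: "1 \<le> a" "a \<le> conj_part \<mu> j" "conj_part \<mu> j < b" "b \<le> n"
    using chain_root_block_bounds[of j \<mu>, OF j i] by (simp_all add: a_def b_def)
  obtain ys where "Gamma_chain n \<mu> = Gamma_from n \<mu> j @ ys"
    using Gamma_chain_prefix[of j \<mu> n] j by auto
  then have chain: "Gamma_chain n \<mu> = Gamma_from n \<mu> (Suc j) @ ?B @ ys"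
    by (simp add: Gamma_from_rec[of j \<mu>, OF j(2)])
  have i_eq: "i = length (Gamma_from n \<mu> (Suc j)) + Suc q" using i by (auto simp: q_def)
  have take: "take i (Gamma_chain n \<mu>) = Gamma_from n \<mu> (Suc j) @ take q ?B @ [(a, b)]"
    using q by (simp add: chain i_eq take_Suc_conv_app_nth)
  have len: "i \<le> length (Gamma_chain n \<mu>)" using q by (simp add: chain i_eq)
  have "affine_level n \<mu> i = card (Suc ` {p. p < i \<and> Gamma_chain n \<mu> ! p = (a, b)})"
    unfolding affine_level_def
  proof (rule arg_cong[where f = card], intro subset_antisym subsetI)
    fix p assume "p \<in> {p. 1 \<le> p \<and> p \<le> i \<and> chain_root n \<mu> p = chain_root n \<mu> i}"
    then show "p \<in> Suc ` {p. p < i \<and> Gamma_chain n \<mu> ! p = (a, b)}"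
      by (intro image_eqI[of _ _ "p - 1"]) (auto simp: chain_root_def a_def b_def)
  qed (auto simp: chain_root_def a_def b_def)
  also have "\<dots> = card {p. p < i \<and> Gamma_chain n \<mu> ! p = (a, b)}"
    by (simp add: card_image)
  also have "{p. p < i \<and> Gamma_chain n \<mu> ! p = (a, b)} =
      {p. p < length (take i (Gamma_chain n \<mu>)) \<and> take i (Gamma_chain n \<mu>) ! p = (a, b)}"
    using len by auto
  also have "card \<dots> = length (filter (\<lambda>r. r = (a, b)) (take i (Gamma_chain n \<mu>)))"
    by (simp add: length_filter_conv_card)
  also have "filter (\<lambda>r. r = (a, b)) (take q ?B) = []"
  proof -
    have "distinct (take (Suc q) ?B)" by (simp add: distinct_Gamma_block)
    then have "(a, b) \<notin> set (take q ?B)" using q by (simp add: take_Suc_conv_app_nth)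
    then show ?thesis by (auto simp: filter_empty_conv)
  qed
  then have "length (filter (\<lambda>r. r = (a, b)) (take i (Gamma_chain n \<mu>))) = \<mu> a + 1 - Suc j + 1"
    using count_Gamma_from[OF part, of "Suc j" a b n] conj_part_antimono[OF part, of j "Suc j"] j ab
    by (simp add: take)
  also have "\<dots> = \<mu> a + 1 - j" using le_conj_part_iff[OF part ab(1) j(1)] ab by simp
  finally show ?thesis by (simp add: a_def)
qed

section \<open>Cutting a folding set into blocks\<close>

lemma sorted_list_of_set_Un:
  fixes A B :: "nat set"
  assumes "finite A" "finite B" "\<forall>x\<in>A. \<forall>y\<in>B. x < y"
  shows "sorted_list_of_set (A \<union> B) = sorted_list_of_set A @ sorted_list_of_set B"
proof (rule sorted_distinct_set_unique)
  show "sorted (sorted_list_of_set A @ sorted_list_of_set B)"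
    using assms by (auto simp: sorted_append intro: less_imp_le)
  show "distinct (sorted_list_of_set A @ sorted_list_of_set B)"
    using assms by fastforce
qed (use assms in simp_all)

text \<open>Keeps the indices of which \<open>T_block\<close> retains only the roots: the affine
  level is a function of the index.\<close>

definition J_block :: "nat \<Rightarrow> (nat \<Rightarrow> nat) \<Rightarrow> nat set \<Rightarrow> nat \<Rightarrow> nat list" where
  "J_block n \<mu> J j = sorted_list_of_set (J \<inter> {length (Gamma_from n \<mu> (j + 1))<..length (Gamma_from n \<mu> j)})"

lemma T_block_conv: "T_block n \<mu> J j = map (chain_root n \<mu>) (J_block n \<mu> J j)"
  by (simp add: T_block_def J_block_def)

lemma set_J_block: "set (J_block n \<mu> J j) = J \<inter> {length (Gamma_from n \<mu> (Suc j))<..length (Gamma_from n \<mu> j)}"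
  by (simp add: J_block_def)

lemma sorted_list_J_blocks:
  assumes "0 \<notin> J" "1 \<le> j" "j \<le> Suc (\<mu> 1)"
  shows "sorted_list_of_set (J \<inter> {..length (Gamma_from n \<mu> j)}) = concat (map (J_block n \<mu> J) (rev [j..<\<mu> 1 + 1]))"
  using assms(3)
proof (induction j rule: inc_induct)
  case base
  have "J \<inter> {..0} = {}" using assms(1) by auto
  then show ?case by (simp add: Gamma_from_end[simplified])
next
  case (step j)
  let ?L = "\<lambda>j. length (Gamma_from n \<mu> j)"
  have le: "?L (Suc j) \<le> ?L j" using step by (subst (2) Gamma_from_rec) auto
  have "J \<inter> {..?L j} = (J \<inter> {..?L (Suc j)}) \<union> (J \<inter> {?L (Suc j)<..?L j})" using le by auto
  then have "sorted_list_of_set (J \<inter> {..?L j}) = sorted_list_of_set (J \<inter> {..?L (Suc j)}) @ J_block n \<mu> J j"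
    by (simp add: sorted_list_of_set_Un J_block_def)
  moreover have "[j..<\<mu> 1 + 1] = j # [Suc j..<\<mu> 1 + 1]" using step by (simp add: upt_conv_Cons del: upt_Suc)
  ultimately show ?case using step.IH by (simp del: upt_Suc)
qed

lemma column_perm_conv:
  "column_perm n \<mu> w J j = mult_roots w (map (chain_root n \<mu>) (concat (map (J_block n \<mu> J) (rev [Suc j..<\<mu> 1 + 1]))))"
proof -
  have "map (T_block n \<mu> J) = map (map (chain_root n \<mu>) \<circ> J_block n \<mu> J)"
    by (simp add: fun_eq_iff T_block_conv)
  then show ?thesis by (simp add: column_perm_def map_concat del: upt_Suc)
qed

text \<open>Block \<open>j\<close> leads from column \<open>j\<close> to column
  \<open>j - 1\<close>. For \<open>j = 1\<close> the result is the end of the whole path, although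
  the filling has no column 0.\<close>

lemma column_perm_rec:
  assumes "1 \<le> j" "j \<le> \<mu> 1"
  shows "column_perm n \<mu> w J (j - 1) = mult_roots (column_perm n \<mu> w J j) (T_block n \<mu> J j)"
proof -
  have "[j..<\<mu> 1 + 1] = j # [Suc j..<\<mu> 1 + 1]" using assms by (simp add: upt_conv_Cons del: upt_Suc)
  then show ?thesis using assms by (simp add: column_perm_def del: upt_Suc)
qed

lemma sorted_T_block:
  assumes "1 \<le> j" "j \<le> \<mu> 1"
  shows "sorted_wrt root_before (T_block n \<mu> J j)"
  unfolding T_block_conv sorted_wrt_map
proof (rule sorted_wrt_mono_rel[of _ "(<)"])
  show "sorted_wrt (<) (J_block n \<mu> J j)" by (simp add: J_block_def)
  fix x y assume "x \<in> set (J_block n \<mu> J j)" "y \<in> set (J_block n \<mu> J j)" and "x < y"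
  then have xy: "x \<in> {length (Gamma_from n \<mu> (Suc j))<..length (Gamma_from n \<mu> j)}"
    "y \<in> {length (Gamma_from n \<mu> (Suc j))<..length (Gamma_from n \<mu> j)}" by (auto simp: set_J_block)
  show "root_before (chain_root n \<mu> x) (chain_root n \<mu> y)"
    using chain_root_block[of j \<mu>, OF assms xy(1)] chain_root_block[of j \<mu>, OF assms xy(2)] \<open>x < y\<close> xy
    by (auto intro!: sorted_wrt_nth_less[OF sorted_Gamma_block])
qed

lemma T_block_bounds:
  assumes "1 \<le> j" "j \<le> \<mu> 1"
  shows "\<forall>r\<in>set (T_block n \<mu> J j). 1 \<le> fst r \<and> fst r \<le> conj_part \<mu> j \<and> conj_part \<mu> j < snd r \<and> snd r \<le> n"
  using chain_root_block_bounds[of j \<mu>, OF assms] by (auto simp: T_block_conv set_J_block)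

lemma sum_list_neg_steps_blocks:
  fixes g :: "nat \<Rightarrow> nat"
  assumes "1 \<le> j" "j \<le> Suc (\<mu> 1)"
  shows "(\<Sum>x\<leftarrow>neg_steps (chain_root n \<mu>) w (concat (map (J_block n \<mu> J) (rev [j..<\<mu> 1 + 1]))). g x) =
    (\<Sum>i\<in>{j..\<mu> 1}. \<Sum>x\<leftarrow>neg_steps (chain_root n \<mu>) (column_perm n \<mu> w J i) (J_block n \<mu> J i). g x)"
  using assms(2)
proof (induction j rule: inc_induct)
  case base
  then show ?case by simp
next
  case (step j)
  have "[j..<\<mu> 1 + 1] = j # [Suc j..<\<mu> 1 + 1]" using step by (simp add: upt_conv_Cons del: upt_Suc)
  moreover have "{j..\<mu> 1} = insert j {Suc j..\<mu> 1}" using step by auto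
  ultimately show ?case using step.IH by (simp add: column_perm_conv del: upt_Suc)
qed

section \<open>The charge algorithm\<close>

text \<open>Starting from a set of biletters turns the removal of selected letters into a set
  difference. The list is reversed because biletters are read in decreasing order.\<close>

definition charge_word :: "(nat \<times> nat) set \<Rightarrow> nat list" where
  "charge_word S = map snd (rev (sorted_list_of_set S))"

lemma max_letter_eqI:
  assumes "{1..m} \<subseteq> set v" and "Suc m \<notin> set v"
  shows "max_letter v = m"
proof -
  have "{k. {1..k} \<subseteq> set v} = {..m}"
  proof (intro subset_antisym subsetI)
    fix k assume "k \<in> {k. {1..k} \<subseteq> set v}"
    then have "Suc m \<notin> {1..k}" using assms(2) by blast
    then show "k \<in> {..m}" by simp
  next
    fix k assume "k \<in> {..m}"
    then show "k \<in> {k. {1..k} \<subseteq> set v}" using assms(1) by force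
  qed
  moreover have "Max {..m} = m" by (rule Max_eqI) auto
  ultimately show ?thesis by (simp add: max_letter_def)
qed

lemma sorted_wrt_nths: "sorted_wrt R xs \<Longrightarrow> sorted_wrt R (nths xs A)"
proof (induction xs arbitrary: A)
  case (Cons x xs)
  then show ?case by (auto simp: nths_Cons dest: in_set_nthsD)
qed simp

text \<open>Here \<open>c j\<close> is the upper letter of the selected biletter with lower letter
  \<open>j\<close>. Moving left in the biword means going up in the upper letters, so the algorithm
  takes the first \<open>Suc j\<close> met cyclically upwards from \<open>c j\<close>. The
  assumption \<open>closest\<close> says that this is \<open>c (Suc j)\<close>; the search restarts
  at the right end exactly when \<open>c (Suc j) < c j\<close>.\<close>

lemma charge_word_pass:
  fixes S :: "(nat \<times> nat) set" and c :: "nat \<Rightarrow> nat"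
  assumes fin: "finite S"
    and mem: "\<And>j. 1 \<le> j \<Longrightarrow> j \<le> m \<Longrightarrow> (c j, j) \<in> S"
    and first: "\<And>y. (y, 1) \<in> S \<Longrightarrow> c 1 \<le> y"
    and closest: "\<And>j y. 1 \<le> j \<Longrightarrow> j < m \<Longrightarrow> (y, Suc j) \<in> S \<Longrightarrow> \<not> in_down (c (Suc j)) (c j) y"
    and none: "\<And>y. (y, Suc m) \<notin> S"
  shows "max_letter (charge_word S) = m"
    and "pass_charge (charge_word S) = (\<Sum>j\<in>{1..<m}. if c (Suc j) < c j then m - j else 0)"
    and "pass_rest (charge_word S) = charge_word (S - (\<lambda>j. (c j, j)) ` {1..m})"
proof -
  define B where "B = rev (sorted_list_of_set S)"
  define v where "v = charge_word S"
  have v: "v = map snd B" by (simp add: v_def charge_word_def B_def)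
  have setB: "set B = S" using fin by (simp add: B_def)
  have "sorted_wrt (>) B" unfolding B_def sorted_wrt_rev by simp
  then have less: "B ! q < B ! p" if "p < q" "q < length B" for p q
    using that by (simp add: sorted_wrt_iff_nth_less)
  have less_iff: "p < q \<longleftrightarrow> B ! q < B ! p" if "p < length B" "q < length B" for p q
    using less[of p q] less[of q p] that by (metis less_asym less_irrefl linorder_neqE_nat)
  have occ: "occurrences_left v p a = {q. q < p \<and> q < length B \<and> snd (B ! q) = a}" for p a
    by (auto simp: occurrences_left_def v)
  \<comment> \<open>The inequality is weak: at equal upper letters the biletter with the larger
    lower letter stands further left.\<close>
  have occ_next: "occurrences_left v p (Suc j) = {q. q < length B \<and> snd (B ! q) = Suc j \<and> x \<le> fst (B ! q)}"
    if "p < length B" "B ! p = (x, j)" for p j x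
    unfolding occ using less_iff[OF _ that(1)] that(2) by (auto simp: less_prod_def')
  \<comment> \<open>Among biletters with the same lower letter, the rightmost is the one with the
    smallest upper letter.\<close>
  have Max_pos: "Max X = q"
    if "X \<subseteq> {q. q < length B \<and> snd (B ! q) = a}" "q \<in> X" "\<And>p. p \<in> X \<Longrightarrow> fst (B ! q) \<le> fst (B ! p)" for X q a
  proof (rule Max_eqI)
    show "finite X" by (rule finite_subset[OF that(1)]) simp
    fix p assume p: "p \<in> X"
    show "p \<le> q"
    proof (rule ccontr)
      assume "\<not> p \<le> q"
      then have "B ! p < B ! q" using less[of q p] p that(1) by auto
      then show False using that(3)[OF p] p that(1,2) by (auto simp: less_prod_def' subset_iff)
    qed
  qed (fact that(2))
  have pos: "\<exists>q < length B. B ! q = x" if "x \<in> S" for x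
    using that unfolding setB[symmetric] by (simp add: in_set_conv_nth)
  have B_in: "B ! q \<in> S" if "q < length B" for q using that setB by auto
  \<comment> \<open>If \<open>c (Suc j) < c j\<close>, the arc kept free by \<open>closest\<close>
    contains all values from \<open>c j\<close> upwards, so no \<open>Suc j\<close> remains to the
    left; otherwise \<open>c (Suc j)\<close> itself occurs there.\<close>
  have empty_iff: "occurrences_left v p (Suc j) = {} \<longleftrightarrow> c (Suc j) < c j"
    if j: "1 \<le> j" "j < m" and p: "p < length B" "B ! p = (c j, j)" for p j
  proof -
    obtain q where q: "q < length B" "B ! q = (c (Suc j), Suc j)" using pos[OF mem[of "Suc j"]] j by auto
    have "c j \<le> c (Suc j)" if "p' < length B" "snd (B ! p') = Suc j" "c j \<le> fst (B ! p')" for p'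
    proof -
      have "(fst (B ! p'), Suc j) \<in> S" using B_in[OF that(1)] that(2) by (metis prod.collapse)
      then show ?thesis using closest[OF j] that(3) by (fastforce simp: in_down_def split: if_splits)
    qed
    then show ?thesis unfolding occ_next[OF p] using q by fastforce
  qed
  have sel: "selected v j < length B \<and> B ! selected v j = (c j, j)" if "1 \<le> j" "j \<le> m" for j
    using that
  proof (induction j rule: dec_induct)
    case base
    obtain q where q: "q < length B" "B ! q = (c 1, 1)" using pos[OF mem[of 1]] base by auto
    let ?X = "occurrences_left v (length v) 1"
    have X: "?X = {q. q < length B \<and> snd (B ! q) = 1}" unfolding occ by (auto simp: v)
    have "Max ?X = q"
    proof (rule Max_pos)
      show "?X \<subseteq> {q. q < length B \<and> snd (B ! q) = 1}" "q \<in> ?X" using q unfolding X by auto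
      fix p assume "p \<in> ?X"
      then show "fst (B ! q) \<le> fst (B ! p)"
        using first[of "fst (B ! p)"] B_in[of p] q unfolding X by (metis (mono_tags, lifting) fst_conv mem_Collect_eq prod.collapse)
    qed
    moreover have "selected v 1 = Max ?X" by simp
    ultimately show ?case using q by simp
  next
    case (step j)
    obtain q where q: "q < length B" "B ! q = (c (Suc j), Suc j)" using pos[OF mem[of "Suc j"]] step by auto
    have IH: "selected v j < length B" "B ! selected v j = (c j, j)" using step by auto
    have j: "1 \<le> j" "j < m" using step by auto
    have not_down: "\<not> in_down (c (Suc j)) (c j) (fst (B ! p))" if "p < length B" "snd (B ! p) = Suc j" for p
    proof -
      have "(fst (B ! p), Suc j) \<in> S" using B_in[OF that(1)] that(2) by (metis prod.collapse)
      then show ?thesis using closest[OF j] by simp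
    qed
    let ?X = "occurrences_left v (selected v j) (Suc j)"
    let ?Y = "occurrences_left v (length v) (Suc j)"
    have X: "?X = {q. q < length B \<and> snd (B ! q) = Suc j \<and> c j \<le> fst (B ! q)}" by (rule occ_next[OF IH])
    have Y: "?Y = {q. q < length B \<and> snd (B ! q) = Suc j}" unfolding occ by (auto simp: v)
    have "selected v (Suc j) = q"
    proof (cases "?X = {}")
      case False
      then have le: "c j \<le> c (Suc j)" using empty_iff[OF j IH] by simp
      have "Max ?X = q"
      proof (rule Max_pos)
        show "?X \<subseteq> {q. q < length B \<and> snd (B ! q) = Suc j}" "q \<in> ?X" using q le unfolding X by auto
        fix p assume "p \<in> ?X"
        then show "fst (B ! q) \<le> fst (B ! p)" using not_down[of p] q le by (auto simp: X in_down_def)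
      qed
      then show ?thesis using False by simp
    next
      case True
      then have le: "c (Suc j) < c j" using empty_iff[OF j IH] by simp
      have "Max ?Y = q"
      proof (rule Max_pos)
        show "?Y \<subseteq> {q. q < length B \<and> snd (B ! q) = Suc j}" "q \<in> ?Y" using q unfolding Y by auto
        fix p assume "p \<in> ?Y"
        then show "fst (B ! q) \<le> fst (B ! p)" using not_down[of p] q le by (auto simp: Y in_down_def)
      qed
      then show ?thesis using True by simp
    qed
    then show ?case using q by simp
  qed
  have setv: "set v = snd ` S" using setB by (simp add: v)
  have max: "max_letter v = m"
  proof (rule max_letter_eqI)
    show "{1..m} \<subseteq> set v" unfolding setv using mem by force
    show "Suc m \<notin> set v" unfolding setv using none by auto
  qed
  then show "max_letter (charge_word S) = m" by (simp add: v_def)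
  show "pass_charge (charge_word S) = (\<Sum>j\<in>{1..<m}. if c (Suc j) < c j then m - j else 0)"
    unfolding v_def[symmetric] pass_charge_def max
    by (rule sum.cong) (use sel empty_iff in auto)
  have "rev (nths B (- (selected v ` {1..m}))) = sorted_list_of_set (S - (\<lambda>j. (c j, j)) ` {1..m})"
  proof (rule sorted_distinct_set_unique)
    have "sorted_wrt (\<ge>) B" using fin by (simp add: B_def sorted_wrt_rev)
    then show "sorted (rev (nths B (- (selected v ` {1..m}))))"
      unfolding sorted_wrt_rev by (rule sorted_wrt_nths)
    show "distinct (rev (nths B (- (selected v ` {1..m}))))" by (simp add: B_def distinct_nthsI)
    have "set (nths B (- (selected v ` {1..m}))) = S - (\<lambda>j. (c j, j)) ` {1..m}"
    proof (intro subset_antisym subsetI)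
      fix x assume "x \<in> set (nths B (- (selected v ` {1..m})))"
      then obtain p where p: "p < length B" "x = B ! p" "p \<notin> selected v ` {1..m}" by (auto simp: set_nths)
      have "x \<noteq> (c j, j)" if "j \<in> {1..m}" for j
      proof
        assume "x = (c j, j)"
        then have "B ! p = B ! selected v j" "selected v j < length B" using sel[of j] that p by auto
        moreover have "distinct B" by (simp add: B_def)
        ultimately have "p = selected v j" using p(1) by (simp add: nth_eq_iff_index_eq)
        then show False using p that by blast
      qed
      then have "x \<notin> (\<lambda>j. (c j, j)) ` {1..m}" by blast
      then show "x \<in> S - (\<lambda>j. (c j, j)) ` {1..m}" using p B_in by simp
    next
      fix x assume x: "x \<in> S - (\<lambda>j. (c j, j)) ` {1..m}"
      then obtain p where p: "p < length B" "B ! p = x" using pos by blast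
      have "p \<notin> selected v ` {1..m}" using x p sel by auto
      then show "x \<in> set (nths B (- (selected v ` {1..m})))" using p by (auto simp: set_nths)
    qed
    then show "set (rev (nths B (- (selected v ` {1..m})))) =
      set (sorted_list_of_set (S - (\<lambda>j. (c j, j)) ` {1..m}))" using fin by simp
  qed simp_all
  then have "nths B (- (selected v ` {1..m})) = rev (sorted_list_of_set (S - (\<lambda>j. (c j, j)) ` {1..m}))"
    by (metis rev_rev_ident)
  then show "pass_rest (charge_word S) = charge_word (S - (\<lambda>j. (c j, j)) ` {1..m})"
    unfolding v_def[symmetric] pass_rest_def max by (simp add: v nths_map charge_word_def)
qed

lemma charge_word_empty: "charge (charge_word {}) = 0"
proof -
  have "max_letter (charge_word {}) = 0" by (rule max_letter_eqI) (auto simp: charge_word_def)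
  then show ?thesis by (simp add: charge.simps)
qed

text \<open>After \<open>i\<close> passes the word consists of the entries of the rows beyond
  \<open>i\<close>. Row \<open>Suc i\<close> is at least as long as the others, so its length is the
  largest letter, and the pass selects exactly its entries. Entries of a column being distinct,
  removing their biletters leaves those of the rows beyond \<open>Suc i\<close>.\<close>

lemma charge_word_rows:
  fixes c :: "nat \<Rightarrow> nat \<Rightarrow> nat" and \<mu> :: "nat \<Rightarrow> nat"
  assumes anti: "\<And>i l. 1 \<le> i \<Longrightarrow> i \<le> l \<Longrightarrow> \<mu> l \<le> \<mu> i" and "\<mu> n = 0"
    and inj: "\<And>j i l. 1 \<le> j \<Longrightarrow> 1 \<le> i \<Longrightarrow> i < l \<Longrightarrow> j \<le> \<mu> l \<Longrightarrow> c j i \<noteq> c j l"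
    and first: "\<And>i l. 1 \<le> i \<Longrightarrow> i < l \<Longrightarrow> 1 \<le> \<mu> l \<Longrightarrow> c 1 i < c 1 l"
    and closest: "\<And>j i l. 1 \<le> j \<Longrightarrow> 1 \<le> i \<Longrightarrow> i < l \<Longrightarrow> Suc j \<le> \<mu> l \<Longrightarrow>
      \<not> in_down (c (Suc j) i) (c j i) (c (Suc j) l)"
    and "i \<le> n" "1 \<le> n"
  shows "charge (charge_word {(c j l, j) | j l. 1 \<le> j \<and> i < l \<and> j \<le> \<mu> l}) =
    (\<Sum>l\<in>{i<..n}. \<Sum>j\<in>{1..<\<mu> l}. if c (Suc j) l < c j l then \<mu> l - j else 0)"
  using \<open>i \<le> n\<close>
proof (induction i rule: inc_induct)
  case base
  have "{(c j l, j) | j l. 1 \<le> j \<and> n < l \<and> j \<le> \<mu> l} = {}"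
    using anti[of n] \<open>\<mu> n = 0\<close> \<open>1 \<le> n\<close> by fastforce
  then have "charge (charge_word {(c j l, j) | j l. 1 \<le> j \<and> n < l \<and> j \<le> \<mu> l}) = 0"
    by (simp only: charge_word_empty)
  then show ?case by simp
next
  case (step i)
  let ?S = "\<lambda>i. {(c j l, j) | j l. 1 \<le> j \<and> i < l \<and> j \<le> \<mu> l}"
  let ?r = "Suc i"
  have S_fin: "finite (?S i)"
  proof (rule finite_subset)
    show "?S i \<subseteq> (\<lambda>(j, l). (c j l, j)) ` ({..\<mu> 1} \<times> {..n})"
    proof
      fix x assume "x \<in> ?S i"
      then obtain j l where x: "x = (c j l, j)" "1 \<le> j" "i < l" "j \<le> \<mu> l" by blast
      have "l \<le> n" using anti[of n l] \<open>\<mu> n = 0\<close> \<open>1 \<le> n\<close> x by (cases "l \<le> n") auto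
      moreover have "j \<le> \<mu> 1" using anti[of 1 l] x by auto
      ultimately show "x \<in> (\<lambda>(j, l). (c j l, j)) ` ({..\<mu> 1} \<times> {..n})" using x by force
    qed
  qed simp
  have p1: "(c j ?r, j) \<in> ?S i" if "1 \<le> j" "j \<le> \<mu> ?r" for j using that by blast
  have p2: "c 1 ?r \<le> y" if y: "(y, 1) \<in> ?S i" for y
  proof -
    obtain l where "y = c 1 l" "i < l" "1 \<le> \<mu> l" using y by blast
    then show ?thesis using first[of ?r l] by (cases "l = ?r") auto
  qed
  have p3: "\<not> in_down (c (Suc j) ?r) (c j ?r) y" if j: "1 \<le> j" "j < \<mu> ?r" and y: "(y, Suc j) \<in> ?S i" for j y
  proof -
    obtain l where l: "y = c (Suc j) l" "i < l" "Suc j \<le> \<mu> l" using y by blast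
    show ?thesis
    proof (cases "l = ?r")
      case True
      then show ?thesis using l by (auto simp: in_down_def)
    next
      case False
      then show ?thesis using closest[of j ?r l] l j by auto
    qed
  qed
  have p4: "(y, Suc (\<mu> ?r)) \<notin> ?S i" for y
  proof
    assume "(y, Suc (\<mu> ?r)) \<in> ?S i"
    then obtain l where "i < l" "Suc (\<mu> ?r) \<le> \<mu> l" by blast
    then show False using anti[of ?r l] by simp
  qed
  have rest: "?S i - (\<lambda>j. (c j ?r, j)) ` {1..\<mu> ?r} = ?S ?r"
  proof (intro subset_antisym subsetI)
    fix x assume x: "x \<in> ?S i - (\<lambda>j. (c j ?r, j)) ` {1..\<mu> ?r}"
    then obtain j l where jl: "x = (c j l, j)" "1 \<le> j" "i < l" "j \<le> \<mu> l" by blast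
    then have "l \<noteq> ?r" using x by auto
    then have "?r < l" using jl by simp
    then show "x \<in> ?S ?r" using jl by blast
  next
    fix x assume x: "x \<in> ?S ?r"
    then obtain j l where jl: "x = (c j l, j)" "1 \<le> j" "?r < l" "j \<le> \<mu> l" by blast
    then have "x \<notin> (\<lambda>j. (c j ?r, j)) ` {1..\<mu> ?r}" using inj[of j ?r l] by auto
    moreover have "i < l" using jl by simp
    ultimately show "x \<in> ?S i - (\<lambda>j. (c j ?r, j)) ` {1..\<mu> ?r}" using jl by blast
  qed
  have pass: "max_letter (charge_word (?S i)) = \<mu> ?r"
    "pass_charge (charge_word (?S i)) = (\<Sum>j\<in>{1..<\<mu> ?r}. if c (Suc j) ?r < c j ?r then \<mu> ?r - j else 0)"
    "pass_rest (charge_word (?S i)) = charge_word (?S i - (\<lambda>j. (c j ?r, j)) ` {1..\<mu> ?r})"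
    by (rule charge_word_pass[of "?S i" "\<mu> ?r" "\<lambda>j. c j ?r"];
        (rule S_fin p1 p2 p3 p4; assumption)?; rule S_fin p4)+
  have split: "{i<..n} = insert ?r {?r<..n}" using step by auto
  show ?case
  \<comment> \<open>If this row is empty, so are all later ones, and the recursion for the charge
    stops.\<close>
  proof (cases "\<mu> ?r = 0")
    case True
    have "\<mu> l = 0" if "l \<in> {i<..n}" for l using anti[of ?r l] that True by simp
    then have "(\<Sum>l\<in>{i<..n}. \<Sum>j\<in>{1..<\<mu> l}. if c (Suc j) l < c j l then \<mu> l - j else 0) = 0"
      by simp
    then show ?thesis using pass(1) True by (simp add: charge.simps)
  next
    case False
    then have "charge (charge_word (?S i)) = pass_charge (charge_word (?S i)) + charge (pass_rest (charge_word (?S i)))"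
      using pass(1) by (subst charge.simps) simp
    also have "\<dots> = (\<Sum>l\<in>{i<..n}. \<Sum>j\<in>{1..<\<mu> l}. if c (Suc j) l < c j l then \<mu> l - j else 0)"
      unfolding pass(2,3) rest step.IH split by simp
    finally show ?thesis .
  qed
qed

section \<open>The charge formula\<close>

lemma chain_root_good:
  assumes "x \<in> {1..length (Gamma_chain n \<mu>)}"
  shows "good_root n (chain_root n \<mu> x)"
proof -
  have "chain_root n \<mu> x \<in> set (Gamma_chain n \<mu>)"
    using assms by (auto simp: chain_root_def intro!: nth_mem)
  then obtain i where "chain_root n \<mu> x \<in> set (Gamma_block n (conj_part \<mu> i))"
    by (auto simp: Gamma_chain_def Gamma_from_def simp del: upt_Suc)
  then show ?thesis by (auto simp: set_Gamma_block good_root_def)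
qed

lemma neg_foldings_conv:
  assumes w: "w permutes {1..n}" and J: "J \<subseteq> {1..length (Gamma_chain n \<mu>)}"
  shows "neg_foldings n \<mu> w J = set (neg_steps (chain_root n \<mu>) w (sorted_list_of_set J))"
proof -
  define js where "js = sorted_list_of_set J"
  have fin: "finite J" using J by (rule finite_subset) simp
  have len: "length js = card J" and setjs: "set js = J" using fin by (simp_all add: js_def)
  have good: "good_root n (chain_root n \<mu> x)" if "x \<in> J" for x using chain_root_good J that by blast
  let ?u = "\<lambda>i. mult_roots w (map (chain_root n \<mu>) (take i js))"
  have step: "bruhat_less n (?u i) (?u (Suc i)) \<longleftrightarrow>
    ?u i (fst (chain_root n \<mu> (js ! i))) < ?u i (snd (chain_root n \<mu> (js ! i)))" if i: "i < length js" for i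
  proof -
    have "?u i permutes {1..n}"
      by (rule mult_roots_permutes[OF w]) (use good setjs in \<open>auto dest: in_set_takeD\<close>)
    moreover have "good_root n (fst (chain_root n \<mu> (js ! i)), snd (chain_root n \<mu> (js ! i)))"
      using good setjs nth_mem[OF i] by simp
    moreover have "?u (Suc i) = mult_root (?u i) (chain_root n \<mu> (js ! i))"
      using i by (simp add: take_Suc_conv_app_nth)
    ultimately show ?thesis using bruhat_less_mult_root_iff by (metis prod.collapse)
  qed
  show ?thesis
    unfolding neg_foldings_def fold_perm_def js_def[symmetric] set_neg_steps_conv_nth
  proof (intro subset_antisym subsetI)
    fix x assume "x \<in> {js ! (i - 1) |i. 1 \<le> i \<and> i \<le> card J \<and> bruhat_less n (?u (i - 1)) (?u i)}"
    then obtain i where i: "x = js ! (i - 1)" "1 \<le> i" "i \<le> card J" "bruhat_less n (?u (i - 1)) (?u i)" by blast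
    then show "x \<in> (!) js ` {i. i < length js \<and>
      ?u i (fst (chain_root n \<mu> (js ! i))) < ?u i (snd (chain_root n \<mu> (js ! i)))}"
      using step[of "i - 1"] len by (intro image_eqI[of _ _ "i - 1"]) auto
  next
    fix x assume "x \<in> (!) js ` {i. i < length js \<and>
      ?u i (fst (chain_root n \<mu> (js ! i))) < ?u i (snd (chain_root n \<mu> (js ! i)))}"
    then obtain i where i: "x = js ! i" "i < length js"
      "?u i (fst (chain_root n \<mu> (js ! i))) < ?u i (snd (chain_root n \<mu> (js ! i)))" by blast
    then have "x = js ! (Suc i - 1) \<and> 1 \<le> Suc i \<and> Suc i \<le> card J \<and> bruhat_less n (?u (Suc i - 1)) (?u (Suc i))"
      using step[of i] len by simp
    then show "x \<in> {js ! (i - 1) |i. 1 \<le> i \<and> i \<le> card J \<and> bruhat_less n (?u (i - 1)) (?u i)}" by blast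
  qed
qed

text \<open>The summand type is general because both real coroot heights and natural affine levels
  are summed.\<close>

lemma sum_neg_foldings:
  fixes g :: "nat \<Rightarrow> 'a::comm_monoid_add"
  assumes "w permutes {1..n}" and "J \<subseteq> {1..length (Gamma_chain n \<mu>)}"
  shows "(\<Sum>x\<in>neg_foldings n \<mu> w J. g x) = (\<Sum>x\<leftarrow>neg_steps (chain_root n \<mu>) w (sorted_list_of_set J). g x)"
  unfolding neg_foldings_conv[OF assms]
  by (rule sum_list_distinct_conv_sum_set[symmetric]) (simp add: distinct_neg_steps)

text \<open>Twice the expression defining \<open>F_bar\<close> is the nonnegative excess of
  \<open>min_path_of_length\<close> plus twice the length of the end. Its vanishing forces both to
  be zero.\<close>

lemma F_bar_min_path:
  assumes "(w, J) \<in> F_bar n \<mu>"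
  shows "min_path w (map (chain_root n \<mu>) (sorted_list_of_set J))"
    and "mult_roots w (map (chain_root n \<mu>) (sorted_list_of_set J)) = id"
proof -
  let ?js = "sorted_list_of_set J"
  let ?v = "mult_roots w (map (chain_root n \<mu>) ?js)"
  have w: "w permutes {1..n}" and J: "J \<subseteq> {1..length (Gamma_chain n \<mu>)}"
    using assms by (auto simp: F_bar_def folding_pairs_def)
  have fin: "finite J" using J by (rule finite_subset) simp
  have good: "\<forall>x\<in>set ?js. good_root n (chain_root n \<mu> x)" using chain_root_good J fin by auto
  have "end_perm n \<mu> w J = ?v" using fin by (simp add: end_perm_def fold_perm_def)
  then have "(1 / 2) * (real (perm_length n w) + real (perm_length n ?v) - real (card J))
       + (\<Sum>x\<leftarrow>neg_steps (chain_root n \<mu>) w ?js. rho_coroot (chain_root n \<mu> x)) = 0"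
    using assms sum_neg_foldings[OF w J, of "\<lambda>x. rho_coroot (chain_root n \<mu> x)"] by (simp add: F_bar_def)
  then have total: "real (perm_length n w) + real (perm_length n ?v) - real (length ?js)
       + 2 * (\<Sum>x\<leftarrow>neg_steps (chain_root n \<mu>) w ?js. rho_coroot (chain_root n \<mu> x)) = 0"
    by (simp add: field_simps)
  note excess = min_path_of_length[OF w good]
  have zero: "perm_length n ?v = 0" using total excess[THEN conjunct1] by linarith
  moreover have "min_path w (map (chain_root n \<mu>) ?js)"
    by (rule excess[THEN conjunct2, rule_format]) (use total zero in linarith)
  ultimately show "min_path w (map (chain_root n \<mu>) ?js)" "?v = id"
    using perm_length_zero_imp_id[OF mult_roots_permutes[OF w]] good by auto
qed

lemma concat_J_blocks:
  assumes "J \<subseteq> {1..length (Gamma_chain n \<mu>)}"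
  shows "concat (map (J_block n \<mu> J) (rev [1..<\<mu> 1 + 1])) = sorted_list_of_set J"
proof -
  have "J \<inter> {..length (Gamma_from n \<mu> 1)} = J" "0 \<notin> J" using assms by (auto simp: Gamma_chain_def)
  then show ?thesis using sorted_list_J_blocks[of J 1 \<mu> n] by simp
qed

lemma F_bar_column_perm:
  assumes F: "(w, J) \<in> F_bar n \<mu>"
  shows "column_perm n \<mu> w J 0 = id"
    and "column_perm n \<mu> w J j permutes {1..n}"
    and "1 \<le> j \<Longrightarrow> j \<le> \<mu> 1 \<Longrightarrow> min_path (column_perm n \<mu> w J j) (T_block n \<mu> J j)"
proof -
  have w: "w permutes {1..n}" and J: "J \<subseteq> {1..length (Gamma_chain n \<mu>)}"
    using F by (auto simp: F_bar_def folding_pairs_def)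
  show "column_perm n \<mu> w J 0 = id"
    using F_bar_min_path(2)[OF F] concat_J_blocks[OF J] by (simp add: column_perm_conv del: upt_Suc)
  show "column_perm n \<mu> w J j permutes {1..n}"
    unfolding column_perm_conv
    by (rule mult_roots_permutes[OF w]) (use chain_root_good J in \<open>auto simp: set_J_block simp del: upt_Suc\<close>)
  show "min_path (column_perm n \<mu> w J j) (T_block n \<mu> J j)" if j: "1 \<le> j" "j \<le> \<mu> 1"
  proof -
    have "[1..<\<mu> 1 + 1] = [1..<j] @ j # [Suc j..<\<mu> 1 + 1]"
      using j upt_add_eq_append[of 1 j "\<mu> 1 + 1 - j"] by (simp add: upt_conv_Cons del: upt_Suc)
    then have "sorted_list_of_set J = concat (map (J_block n \<mu> J) (rev [Suc j..<\<mu> 1 + 1])) @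
      J_block n \<mu> J j @ concat (map (J_block n \<mu> J) (rev [1..<j]))"
      using concat_J_blocks[OF J] by (simp del: upt_Suc)
    then show ?thesis using F_bar_min_path(1)[OF F]
      by (simp add: column_perm_conv T_block_conv del: upt_Suc)
  qed
qed

text \<open>The negative foldings are counted block by block and row by row, each with weight
  \<open>\<mu> i + 1 - j\<close>, and the two sums are exchanged. A rise in block
  \<open>j + 1\<close> is a descent in column \<open>j\<close>, and block 1 contributes
  nothing.\<close>

lemma level_conv_sum:
  assumes part: "is_partition \<mu>" and "\<mu> n = 0" and "1 \<le> n" and F: "(w, J) \<in> F_bar n \<mu>"
  defines "\<pi> \<equiv> column_perm n \<mu> w J"
  shows "level n \<mu> w J = (\<Sum>i\<in>{1..n}. \<Sum>j\<in>{1..<\<mu> i}. if \<pi> (Suc j) i < \<pi> j i then \<mu> i - j else 0)"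
proof -
  have w: "w permutes {1..n}" and J: "J \<subseteq> {1..length (Gamma_chain n \<mu>)}"
    using F by (auto simp: F_bar_def folding_pairs_def)
  let ?F = "\<lambda>j i. if \<pi> j i < \<pi> (j - 1) i then \<mu> i + 1 - j else 0"
  have block: "(\<Sum>x\<leftarrow>neg_steps (chain_root n \<mu>) (\<pi> j) (J_block n \<mu> J j). affine_level n \<mu> x)
    = (\<Sum>i\<in>{1..conj_part \<mu> j}. ?F j i)" if j: "1 \<le> j" "j \<le> \<mu> 1" for j
  proof -
    let ?N = "neg_steps (chain_root n \<mu>) (\<pi> j) (J_block n \<mu> J j)"
    have "affine_level n \<mu> x = \<mu> (fst (chain_root n \<mu> x)) + 1 - j" if "x \<in> set ?N" for x
      using set_neg_steps_subset[of "chain_root n \<mu>" "\<pi> j" "J_block n \<mu> J j"] that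
      by (intro affine_level_block[OF part j]) (auto simp: set_J_block)
    then have "(\<Sum>x\<leftarrow>?N. affine_level n \<mu> x) = (\<Sum>x\<leftarrow>?N. \<mu> (fst (chain_root n \<mu> x)) + 1 - j)"
      by (intro arg_cong[where f = sum_list] map_cong) auto
    also have "\<dots> = (\<Sum>r\<leftarrow>neg_steps (\<lambda>r. r) (\<pi> j) (T_block n \<mu> J j). \<mu> (fst r) + 1 - j)"
      unfolding T_block_conv map_neg_steps[symmetric] by (simp add: o_def)
    also have "\<dots> = (\<Sum>i\<in>{1..conj_part \<mu> j}. if \<pi> j i < mult_roots (\<pi> j) (T_block n \<mu> J j) i then \<mu> i + 1 - j else 0)"
      using F_bar_column_perm(2,3)[OF F] sorted_T_block[of j \<mu> n J, OF j] T_block_bounds[of j \<mu> n J, OF j] j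
      unfolding \<pi>_def by (intro neg_steps_weight) auto
    finally show ?thesis using column_perm_rec[of j \<mu> n w J, OF j] by (simp add: \<pi>_def)
  qed
  \<comment> \<open>There is no cell in a column 0 to account for a rise in block 1. None occurs,
    because the entry of row \<open>i\<close> is at least its final value \<open>i\<close>.\<close>
  have first: "?F 1 i = 0" if "1 \<le> i" "1 \<le> \<mu> i" for i
  proof -
    have \<mu>1: "1 \<le> \<mu> 1" using partition_antimono[OF part, of 1 i] that by simp
    have "mult_roots (\<pi> 1) (T_block n \<mu> J 1) = id"
      using column_perm_rec[of 1 \<mu> n w J] \<mu>1 F_bar_column_perm(1)[OF F] by (simp add: \<pi>_def)
    moreover have "i \<le> conj_part \<mu> 1" using le_conj_part_iff[OF part, of i 1] that by simp
    ultimately have "i \<le> \<pi> 1 i"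
      using min_path_to_id(1)[of "\<pi> 1" n "T_block n \<mu> J 1" "conj_part \<mu> 1" i] F_bar_column_perm(2,3)[OF F]
        sorted_T_block[of 1 \<mu> n J] T_block_bounds[of 1 \<mu> n J] \<mu>1 that
        conj_part_less[OF part assms(2,3), of 1] by (simp add: \<pi>_def)
    then show ?thesis using F_bar_column_perm(1)[OF F] by (simp add: \<pi>_def)
  qed
  have "level n \<mu> w J = (\<Sum>x\<leftarrow>neg_steps (chain_root n \<mu>) w (sorted_list_of_set J). affine_level n \<mu> x)"
    unfolding level_def by (rule sum_neg_foldings[OF w J])
  also have "\<dots> = (\<Sum>j\<in>{1..\<mu> 1}. \<Sum>x\<leftarrow>neg_steps (chain_root n \<mu>) (\<pi> j) (J_block n \<mu> J j). affine_level n \<mu> x)"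
    unfolding concat_J_blocks[OF J, symmetric] \<pi>_def by (rule sum_list_neg_steps_blocks) auto
  also have "\<dots> = (\<Sum>j\<in>{1..\<mu> 1}. \<Sum>i\<in>{i. i \<in> {1..n} \<and> j \<le> \<mu> i}. ?F j i)"
  proof (rule sum.cong[OF refl])
    fix j assume "j \<in> {1..\<mu> 1}"
    then have j: "1 \<le> j" "j \<le> \<mu> 1" by auto
    have "{1..conj_part \<mu> j} = {i. i \<in> {1..n} \<and> j \<le> \<mu> i}"
      using le_conj_part_iff[OF part _ j(1)] conj_part_less[OF part assms(2,3) j(1)] by force
    then show "(\<Sum>x\<leftarrow>neg_steps (chain_root n \<mu>) (\<pi> j) (J_block n \<mu> J j). affine_level n \<mu> x) =
      (\<Sum>i\<in>{i. i \<in> {1..n} \<and> j \<le> \<mu> i}. ?F j i)" using block[OF j] by simp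
  qed
  also have "\<dots> = (\<Sum>i\<in>{1..n}. \<Sum>j\<in>{j. j \<in> {1..\<mu> 1} \<and> j \<le> \<mu> i}. ?F j i)"
    by (rule sum.swap_restrict) auto
  also have "\<dots> = (\<Sum>i\<in>{1..n}. \<Sum>j\<in>{1..<\<mu> i}. if \<pi> (Suc j) i < \<pi> j i then \<mu> i - j else 0)"
  proof (rule sum.cong[OF refl])
    fix i assume i: "i \<in> {1..n}"
    have eq: "{j. j \<in> {1..\<mu> 1} \<and> j \<le> \<mu> i} = {1..\<mu> i}"
      using partition_antimono[OF part, of 1 i] i by auto
    show "(\<Sum>j\<in>{j. j \<in> {1..\<mu> 1} \<and> j \<le> \<mu> i}. ?F j i) =
      (\<Sum>j\<in>{1..<\<mu> i}. if \<pi> (Suc j) i < \<pi> j i then \<mu> i - j else 0)"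
    proof (cases "\<mu> i")
      case (Suc m)
      \<comment> \<open>Splits off block 1 and shifts the index from the block to the column in
        which the descent occurs.\<close>
      have "{1..\<mu> i} = insert 1 (Suc ` {1..<\<mu> i})" by (auto simp: Suc image_iff Suc_le_eq dest: gr0_implies_Suc)
      then have "(\<Sum>j\<in>{1..\<mu> i}. ?F j i) = ?F 1 i + (\<Sum>j\<in>Suc ` {1..<\<mu> i}. ?F j i)"
        by (simp only:) (subst sum.insert, auto)
      also have "\<dots> = (\<Sum>j\<in>{1..<\<mu> i}. if \<pi> (Suc j) i < \<pi> j i then \<mu> i - j else 0)"
        using first[of i] i Suc by (subst sum.reindex) (auto intro!: sum.cong)
      finally show ?thesis by (simp only: eq)
    qed (simp add: eq)
  qed
  finally show ?thesis .
qed

section \<open>Arms, descents and the charge word of the filling\<close>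

lemma cells_conv:
  assumes "is_partition \<mu>"
  shows "cells \<mu> = {(j, i). 1 \<le> i \<and> 1 \<le> j \<and> j \<le> \<mu> i}"
proof -
  have "j \<le> \<mu> 1" if "1 \<le> i" "j \<le> \<mu> i" for i j
    using partition_antimono[OF assms, of 1 i] that by simp
  then show ?thesis using le_conj_part_iff[OF assms] by (auto simp: cells_def)
qed

lemma arm_conv:
  assumes "is_partition \<mu>" "1 \<le> i"
  shows "arm \<mu> (j, i) = \<mu> i - j"
proof -
  have "{c' \<in> cells \<mu>. snd c' = snd (j, i) \<and> fst c' > fst (j, i)} = (\<lambda>j. (j, i)) ` {j<..\<mu> i}"
    unfolding cells_conv[OF assms(1)] using assms(2) by auto
  then show ?thesis by (simp add: arm_def card_image inj_on_def)
qed

lemma entry_fill_map: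
  assumes "(j, i) \<in> cells \<mu>"
  shows "entry (fill_map n \<mu> w J) j i = column_perm n \<mu> w J j i"
  using assms by (auto simp: cells_def entry_def fill_map_def simp del: upt_Suc)

text \<open>A regrouping by rows, in which the cell of column \<open>j\<close> and row
  \<open>i\<close> has arm \<open>\<mu> i - j\<close>.\<close>

lemma sum_arm_descents:
  fixes w :: "nat \<Rightarrow> nat" and J :: "nat set"
  assumes part: "is_partition \<mu>" and "\<mu> n = 0" and "1 \<le> n"
  defines "\<pi> \<equiv> column_perm n \<mu> w J"
  shows "(\<Sum>c\<in>descents \<mu> (fill_map n \<mu> w J). arm \<mu> c) =
    (\<Sum>i\<in>{1..n}. \<Sum>j\<in>{1..<\<mu> i}. if \<pi> (Suc j) i < \<pi> j i then \<mu> i - j else 0)"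
proof -
  let ?P = "SIGMA i:{1..n}. {1..<\<mu> i}"
  have D: "descents \<mu> (fill_map n \<mu> w J) = {(j, i). 1 \<le> i \<and> 1 \<le> j \<and> Suc j \<le> \<mu> i \<and> \<pi> (Suc j) i < \<pi> j i}"
    unfolding descents_def using entry_fill_map
    by (auto simp: cells_conv[OF part] \<pi>_def)
  have le: "i \<le> n" if "1 \<le> \<mu> i" for i
    using partition_antimono[OF part \<open>1 \<le> n\<close>, of i] \<open>\<mu> n = 0\<close> that by (cases "i \<le> n") auto
  have "(\<Sum>i\<in>{1..n}. \<Sum>j\<in>{1..<\<mu> i}. if \<pi> (Suc j) i < \<pi> j i then \<mu> i - j else 0) =
    (\<Sum>(i, j)\<in>?P. if \<pi> (Suc j) i < \<pi> j i then \<mu> i - j else 0)"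
    by (rule sum.Sigma) auto
  also have "\<dots> = (\<Sum>(i, j)\<in>{(i, j) \<in> ?P. \<pi> (Suc j) i < \<pi> j i}. \<mu> i - j)"
    by (rule sum.mono_neutral_cong_right) (auto split: if_splits)
  also have "\<dots> = (\<Sum>c\<in>descents \<mu> (fill_map n \<mu> w J). arm \<mu> c)"
    by (rule sum.reindex_bij_witness[of _ prod.swap prod.swap])
      (use le in \<open>fastforce simp: D arm_conv[OF part]\<close>)+
  finally show ?thesis by simp
qed

text \<open>Sorting the biword forgets the order within columns, and distinct entries in a column
  prevent repeated biletters; the word thus depends only on the set of biletters.\<close>

lemma cw2_ord_filling:
  assumes distinct: "\<And>j. distinct (\<sigma> j)"
  shows "cw2 \<mu> (ord_filling \<sigma>) = charge_word {(x, j) | x j. 1 \<le> j \<and> j \<le> \<mu> 1 \<and> x \<in> set (\<sigma> j)}"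
proof -
  let ?xs = "concat (map (\<lambda>j. map (\<lambda>k. (k, j)) (ord_filling \<sigma> j)) [1..<\<mu> 1 + 1])"
  have "set ?xs = {(x, j) | x j. 1 \<le> j \<and> j \<le> \<mu> 1 \<and> x \<in> set (\<sigma> j)}"
    by (auto simp: ord_filling_def simp del: upt_Suc) force
  moreover have "distinct (concat (map (\<lambda>j. map (\<lambda>k. (k, j)) (ord_filling \<sigma> j)) js))" if "distinct js" for js
    using that distinct by (induction js) (auto simp: ord_filling_def distinct_map inj_on_def)
  then have "distinct ?xs" by (simp del: upt_Suc)
  then have "sort ?xs = sorted_list_of_set (set ?xs)"
    unfolding sorted_list_of_set_sort_remdups by (simp only: distinct_remdups_id)
  ultimately show ?thesis by (simp add: cw2_def charge_biword_def charge_word_def del: upt_Suc)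
qed

text \<open>As the word depends only on the sets of entries, the unsorted columns may supply its
  rows. Block \<open>j + 1\<close> moves row \<open>i\<close> from column \<open>j + 1\<close> to
  column \<open>j\<close> without passing a later entry of column \<open>j + 1\<close>, which is the
  selection rule, and block 1 ending at the identity makes column 1 increasing, which is the rule
  for the first letter.\<close>

lemma charge_conv_sum:
  assumes part: "is_partition \<mu>" and "\<mu> n = 0" and "1 \<le> n" and F: "(w, J) \<in> F_bar n \<mu>"
  defines "\<pi> \<equiv> column_perm n \<mu> w J"
  shows "charge (cw2 \<mu> (ord_filling (fill_map n \<mu> w J))) =
    (\<Sum>i\<in>{1..n}. \<Sum>j\<in>{1..<\<mu> i}. if \<pi> (Suc j) i < \<pi> j i then \<mu> i - j else 0)"
proof -
  let ?\<sigma> = "fill_map n \<mu> w J"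
  have perm: "\<pi> j permutes {1..n}" for j unfolding \<pi>_def by (rule F_bar_column_perm(2)[OF F])
  have inj: "\<pi> j i = \<pi> j l \<longleftrightarrow> i = l" for j i l using permutes_inj[OF perm] by (auto dest: injD)
  have path: "sorted_wrt root_before (T_block n \<mu> J j)"
    "\<forall>r\<in>set (T_block n \<mu> J j). 1 \<le> fst r \<and> fst r \<le> conj_part \<mu> j \<and> conj_part \<mu> j < snd r \<and> snd r \<le> n"
    "min_path (\<pi> j) (T_block n \<mu> J j)" "mult_roots (\<pi> j) (T_block n \<mu> J j) = \<pi> (j - 1)"
    if "1 \<le> j" "j \<le> \<mu> 1" for j
    using that sorted_T_block[of j \<mu> n J] T_block_bounds[of j \<mu> n J] F_bar_column_perm(3)[OF F, of j]
      column_perm_rec[of j \<mu> n w J] by (simp_all add: \<pi>_def)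
  have le1: "j \<le> \<mu> 1" if "1 \<le> l" "j \<le> \<mu> l" for j l
    using partition_antimono[OF part, of 1 l] that by simp
  have set: "{(x, j) | x j. 1 \<le> j \<and> j \<le> \<mu> 1 \<and> x \<in> set (?\<sigma> j)} = {(\<pi> j l, j) | j l. 1 \<le> j \<and> 0 < l \<and> j \<le> \<mu> l}"
  proof -
    have "set (?\<sigma> j) = \<pi> j ` {l. 0 < l \<and> j \<le> \<mu> l}" if "1 \<le> j" for j
    proof -
      have "set (?\<sigma> j) = \<pi> j ` {1..<conj_part \<mu> j + 1}"
        by (simp add: fill_map_def \<pi>_def del: upt_Suc)
      also have "{1..<conj_part \<mu> j + 1} = {l. 0 < l \<and> j \<le> \<mu> l}"
        using le_conj_part_iff[OF part _ that] by (auto simp: less_Suc_eq_le Suc_le_eq)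
      finally show ?thesis .
    qed
    then have "(x, j) \<in> {(x, j) | x j. 1 \<le> j \<and> j \<le> \<mu> 1 \<and> x \<in> set (?\<sigma> j)} \<longleftrightarrow>
      (x, j) \<in> {(\<pi> j l, j) | j l. 1 \<le> j \<and> 0 < l \<and> j \<le> \<mu> l}" for x j
      using le1 by (cases "1 \<le> j") (auto simp: Suc_le_eq)
    then show ?thesis by (intro set_eqI) (simp only: split_paired_all)
  qed
  have "distinct (?\<sigma> j)" for j using inj by (simp add: fill_map_def distinct_map inj_on_def \<pi>_def del: upt_Suc)
  then have "charge (cw2 \<mu> (ord_filling ?\<sigma>)) =
    charge (charge_word {(\<pi> j l, j) | j l. 1 \<le> j \<and> 0 < l \<and> j \<le> \<mu> l})"
    by (simp only: cw2_ord_filling set)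
  also have "\<dots> = (\<Sum>l\<in>{0<..n}. \<Sum>j\<in>{1..<\<mu> l}. if \<pi> (Suc j) l < \<pi> j l then \<mu> l - j else 0)"
  proof (rule charge_word_rows)
    show "\<mu> l \<le> \<mu> i" if "1 \<le> i" "i \<le> l" for i l using partition_antimono[OF part that] .
    show "\<pi> j i \<noteq> \<pi> j l" if "i < l" for j i l using inj that by simp
    show "\<pi> 1 i < \<pi> 1 l" if il: "1 \<le> i" "i < l" "1 \<le> \<mu> l" for i l
    proof -
      have \<mu>1: "1 \<le> \<mu> 1" using le1[of l 1] il by simp
      have l: "l \<le> conj_part \<mu> 1" using le_conj_part_iff[OF part, of l 1] il by simp
      have "mult_roots (\<pi> 1) (T_block n \<mu> J 1) = id"
        using path(4)[of 1] \<mu>1 F_bar_column_perm(1)[OF F] by (simp add: \<pi>_def)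
      then show ?thesis
        using min_path_to_id(2)[OF perm path(1-3), of 1 i l] \<mu>1 il l
          conj_part_less[OF part assms(2,3), of 1] by simp
    qed
    show "\<not> in_down (\<pi> (Suc j) i) (\<pi> j i) (\<pi> (Suc j) l)"
      if il: "1 \<le> j" "1 \<le> i" "i < l" "Suc j \<le> \<mu> l" for j i l
    proof -
      have \<mu>1: "Suc j \<le> \<mu> 1" using le1[of l "Suc j"] il by simp
      have "l \<le> conj_part \<mu> (Suc j)" using le_conj_part_iff[OF part, of l "Suc j"] il by simp
      then show ?thesis
        using min_path_block(2)[OF perm path(1-3), of "Suc j" i l] path(4)[of "Suc j"] \<mu>1 il by simp
    qed
  qed (use assms in auto)
  also have "{0<..n} = {1..n}" by auto
  finally show ?thesis .
qed

theorem theorem4p11: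
  fixes n :: nat and \<mu> :: "nat \<Rightarrow> nat" and w :: "nat \<Rightarrow> nat" and J :: "nat set"
    and \<sigma> \<tau> :: filling
  assumes "n \<ge> 2"
    and "is_partition \<mu>" and "\<mu> n = 0"
    and "(w, J) \<in> F_bar n \<mu>"
    and "\<sigma> = fill_map n \<mu> w J" and "\<tau> = ord_filling \<sigma>"
  shows "level n \<mu> w J = (\<Sum>c\<in>descents \<mu> \<sigma>. arm \<mu> c)
       \<and> (\<Sum>c\<in>descents \<mu> \<sigma>. arm \<mu> c) = charge (cw2 \<mu> \<tau>)"
  \<comment> \<open>All three quantities have been brought to the same double sum over rows and
    columns.\<close>
  using level_conv_sum[of \<mu> n w J] sum_arm_descents[of \<mu> n w J] charge_conv_sum[of \<mu> n w J] assms
  by simp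

end
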